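(* Fix $K>1$ and a distribution $F$ over the simplex $V=\{x\in\mathbb{R}^K:x_k\ge0,\ \sum_kx_k=1\}$; let $\pi_i\stackrel{iid}{\sim}F$, $1\le i\le n$, and $h=\mathbb{E}[\pi_i]$. Let $D$ be the unique diagonal matrix with positive diagonal entries such that $DPDh=1_K$, and let $$\widetilde\pi_i=D\pi_i/\|D\pi_i\|_1,\qquad\widetilde\theta_i=\|D\pi_i\|_1\cdot\theta_i,\qquad\widetilde\Pi=[\widetilde\pi_1,\ldots,\widetilde\pi_n]',\qquad\widetilde\Theta=\mathrm{diag}(\widetilde\theta_1,\ldots,\widetilde\theta_n).$$ Consider a sequence of DCMM model pairs indexed by $n$: $$H_0^{(n)}:\ \Omega=\theta\theta'\qquad\text{and}\qquad H_1^{(n)}:\ \Omega=\widetilde\Theta\widetilde\Pi P\widetilde\Pi'\widetilde\Theta.$$ If $\theta_{\max}\le c_0$ for a constant $c_0<1$, $$\min_{1\le k\le K}\{h_k\}\ge C,\qquad\text{and}\qquad\|\theta\|\cdot|\mu_2(P)|\to0,$$ for a constant $C>0$, then for each pair of two hypotheses the $\chi^2$-distance between the two joint distributions tends to $0$ as $n\to\infty$.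
   Context: $\theta\in\mathbb{R}^n$ has positive entries; $P\in\mathbb{R}^{K\times K}$ is symmetric, entrywise nonnegative, with unit diagonal; $\theta$ and $P$ are non-stochastic and may depend on $n$. Given $\Omega$ (possibly random through the $\pi_i$), the adjacency matrix $A\in\{0,1\}^{n\times n}$ is symmetric with zero diagonal, and its entries $A_{ij}$, $i<j$, are conditionally independent Bernoulli with $\mathbb{P}(A_{ij}=1\mid\Omega)=\Omega_{ij}\in[0,1]$. The two joint distributions are the laws $P_0^{(n)}$, $P_1^{(n)}$ of $A$ under $H_0^{(n)}$ and $H_1^{(n)}$ (under $H_1^{(n)}$, averaged over the $\pi_i$). Their $\chi^2$-distance is $\int(dP_1^{(n)}/dP_0^{(n)})^2\,dP_0^{(n)}-1$. $\mu_k(P)$ is the $k$-th largest eigenvalue of $P$ in magnitude. $\|\theta\|$ is the $\ell^2$-norm, $\|\cdot\|_1$ the $\ell^1$-norm, $\theta_{\max}=\max_i\theta_i$, $1_K$ is the all-ones vector. *)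

theory Defs
  imports "HOL-Probability.Probability" "HOL-Computational_Algebra.Polynomial"
begin

section \<open>Linear algebra in dimension K\<close>

definition std_simplex :: "(real ^ 'k) set" where
  "std_simplex = {x. (\<forall>k. 0 \<le> x $ k) \<and> (\<Sum>k\<in>UNIV. x $ k) = 1}"

definition l1_norm :: "real ^ 'k \<Rightarrow> real" where
  "l1_norm x = (\<Sum>k\<in>UNIV. \<bar>x $ k\<bar>)"

definition charpoly :: "real ^ 'k ^ 'k \<Rightarrow> real poly" where
  "charpoly M = det (mat [:0, 1:] - map_matrix (\<lambda>c. [:c:]) M)"

text \<open>
  The real eigenvalues with algebraic multiplicity, in order of decreasing magnitude; for a
  symmetric matrix these are all the eigenvalues, so the list has length \<open>CARD('k)\<close>.
  The order among eigenvalues of equal magnitude is immaterial for \<open>\<bar>eigval_mag k M\<bar>\<close>.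
\<close>
definition eigvals_by_mag :: "real ^ 'k ^ 'k \<Rightarrow> real list" where
  "eigvals_by_mag M =
     sort_key (\<lambda>x. - \<bar>x\<bar>) (sorted_list_of_multiset (proots (charpoly M)))"

definition eigval_mag :: "nat \<Rightarrow> real ^ 'k ^ 'k \<Rightarrow> real" where
  "eigval_mag k M = eigvals_by_mag M ! (k - 1)"

text \<open>
  The normalisation \<open>D P D h = 1\<^sub>K\<close>. For \<open>P\<close> symmetric, nonnegative with unit diagonal and \<open>h\<close>
  with positive entries there is exactly one such \<open>D\<close>. The vector \<open>1\<close> is the all-ones vector.
\<close>
definition diag_scaling :: "real ^ 'k ^ 'k \<Rightarrow> real ^ 'k \<Rightarrow> real ^ 'k ^ 'k \<Rightarrow> bool" where
  "diag_scaling P h D \<longleftrightarrow>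
     (\<forall>k l. k \<noteq> l \<longrightarrow> D $ k $ l = 0) \<and> (\<forall>k. 0 < D $ k $ k) \<and>
     (D ** P ** D) *v h = 1"

section \<open>The model\<close>

text \<open>
  Nodes are \<open>0, \<dots>, n - 1\<close>. Vectors of length \<open>n\<close> and \<open>n \<times> n\<close> matrices are functions on
  \<open>nat\<close>, of which only the entries with indices below \<open>n\<close> are relevant.
\<close>

definition tilde_pi :: "real ^ 'k ^ 'k \<Rightarrow> (nat \<Rightarrow> real ^ 'k) \<Rightarrow> nat \<Rightarrow> real ^ 'k" where
  "tilde_pi D \<pi> i = (1 / l1_norm (D *v \<pi> i)) *\<^sub>R (D *v \<pi> i)"

definition tilde_theta ::
    "real ^ 'k ^ 'k \<Rightarrow> (nat \<Rightarrow> real) \<Rightarrow> (nat \<Rightarrow> real ^ 'k) \<Rightarrow> nat \<Rightarrow> real" where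
  "tilde_theta D \<theta> \<pi> i = l1_norm (D *v \<pi> i) * \<theta> i"

definition dcmm_Omega ::
    "(nat \<Rightarrow> real) \<Rightarrow> (nat \<Rightarrow> real ^ 'k) \<Rightarrow> real ^ 'k ^ 'k \<Rightarrow> nat \<Rightarrow> nat \<Rightarrow> real" where
  "dcmm_Omega \<theta> \<pi> P i j = \<theta> i * (\<pi> i \<bullet> (P *v \<pi> j)) * \<theta> j"

definition null_Omega :: "(nat \<Rightarrow> real) \<Rightarrow> nat \<Rightarrow> nat \<Rightarrow> real" where
  "null_Omega \<theta> i j = \<theta> i * \<theta> j"

definition alt_Omega ::
    "real ^ 'k ^ 'k \<Rightarrow> real ^ 'k ^ 'k \<Rightarrow> (nat \<Rightarrow> real) \<Rightarrow> (nat \<Rightarrow> real ^ 'k) \<Rightarrow> nat \<Rightarrow> nat \<Rightarrow> real" where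
  "alt_Omega D P \<theta> \<pi> = dcmm_Omega (tilde_theta D \<theta> \<pi>) (tilde_pi D \<pi>) P"

text \<open>
  The law of the adjacency matrix given \<open>\<Omega>\<close>: independent Bernoulli entries for \<open>i < j < n\<close>,
  symmetrised, with zero diagonal (and zero outside the \<open>n \<times> n\<close> block).
\<close>
definition adj_pmf :: "nat \<Rightarrow> (nat \<Rightarrow> nat \<Rightarrow> real) \<Rightarrow> (nat \<Rightarrow> nat \<Rightarrow> nat) pmf" where
  "adj_pmf n \<Omega> =
     map_pmf (\<lambda>e i j. of_bool (if i < j then e (i, j) else if j < i then e (j, i) else False))
       (Pi_pmf {(i, j). i < j \<and> j < n} False (\<lambda>(i, j). bernoulli_pmf (\<Omega> i j)))"

text \<open>\<open>bernoulli_pmf p\<close> truncates \<open>p\<close> to the unit interval; a proper model needs no truncation.\<close>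
definition edge_probs :: "nat \<Rightarrow> (nat \<Rightarrow> nat \<Rightarrow> real) \<Rightarrow> bool" where
  "edge_probs n \<Omega> \<longleftrightarrow> (\<forall>i j. i < j \<and> j < n \<longrightarrow> \<Omega> i j \<in> {0..1})"

definition null_law :: "nat \<Rightarrow> (nat \<Rightarrow> real) \<Rightarrow> (nat \<Rightarrow> nat \<Rightarrow> nat) measure" where
  "null_law n \<theta> = measure_pmf (adj_pmf n (null_Omega \<theta>))"

abbreviation iid :: "nat \<Rightarrow> 'a measure \<Rightarrow> (nat \<Rightarrow> 'a) measure" where
  "iid n F \<equiv> PiM {..<n} (\<lambda>_. F)"

definition alt_law ::
    "nat \<Rightarrow> (real ^ 'k) measure \<Rightarrow> real ^ 'k ^ 'k \<Rightarrow> real ^ 'k ^ 'k \<Rightarrow> (nat \<Rightarrow> real) \<Rightarrow>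
     (nat \<Rightarrow> nat \<Rightarrow> nat) measure" where
  "alt_law n F D P \<theta> =
     Giry_Monad.bind (iid n F) (\<lambda>\<pi>. measure_pmf (adj_pmf n (alt_Omega D P \<theta> \<pi>)))"

text \<open>
  If \<open>P\<^sub>1\<close> is not absolutely continuous with respect to \<open>P\<^sub>0\<close>, or the squared density is not
  integrable, the library's default values make this \<open>-1\<close>; for probability measures the value
  is nonnegative in all other cases.
\<close>
definition chi2_dist :: "'a measure \<Rightarrow> 'a measure \<Rightarrow> real" where
  "chi2_dist P\<^sub>0 P\<^sub>1 = (\<integral>x. (enn2real (RN_deriv P\<^sub>0 P\<^sub>1 x))\<^sup>2 \<partial>P\<^sub>0) - 1"

end

theory Submission
  imports Defs
begin

text \<open>
  Write \<open>M = D P D\<close>. Since \<open>M h = 1\<close>, the alternative has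
  \<open>\<Omega> i j = \<theta> i * \<theta> j * (1 + \<kappa> (\<pi> i) (\<pi> j))\<close> with the bilinear form
  \<open>\<kappa> y z = (y - h) \<bullet> M (z - h)\<close> in the centred memberships. Two facts about \<open>\<kappa>\<close> carry the proof.
  It is degenerate: its mean over either argument is zero. And it is small: \<open>\<bar>\<kappa>\<bar> \<le> B * \<bar>\<mu>\<^sub>2(P)\<bar>\<close> on
  the simplex, with \<open>B\<close> depending on \<open>C\<close> only (\<open>centred_form_le\<close>). The latter holds because \<open>P\<close>
  is, up to an error of norm \<open>\<bar>\<mu>\<^sub>2(P)\<bar>\<close>, a multiple of the projection onto a nonnegative eigenvector
  (\<open>near_rank_one\<close>), and the normalisation makes the centred vectors nearly blind to that
  eigenvector.

  Expanding the likelihood ratio in products of centred edge indicators gives the \<open>\<chi>\<^sup>2\<close>-distance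
  plus one as a sum over all edge sets \<open>J\<close> of squared coefficients (\<open>chi2_mixture\<close>). The coefficient
  of \<open>J\<close> is, up to a weight, the mean of \<open>\<Prod>(i, j)\<in>J. \<kappa> (\<pi> i) (\<pi> j)\<close>, which by degeneracy vanishes
  as soon as some vertex has degree one in \<open>J\<close> (\<open>degenerate_leaf_integral\<close>). So
  \<open>1 \<le> \<chi>\<^sup>2 + 1 \<le> \<Sum>J. \<Prod>(i, j)\<in>J. a i * a j\<close>, the sum over \<open>J\<close> without leaves, where \<open>a i\<close> is
  proportional to \<open>\<bar>\<mu>\<^sub>2(P)\<bar> * \<theta> i\<close>; here \<open>\<theta> i * \<theta> j\<close> being bounded away from \<open>1\<close> is used.

  To bound this sum, let \<open>R i\<close> be independent centred two-valued variables all of whose moments of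
  order at least two are at least one. The indicator of having no leaf is then at most the mean of
  \<open>\<Prod>(i, j)\<in>J. R i * R j\<close>, and the sum over \<open>J\<close> collapses to a product:
  it is at most the mean of \<open>exp (1/2 * (\<Sum>i. a i * R i)\<^sup>2)\<close> (\<open>leafless_sum_le\<close>). As the \<open>R i\<close> are
  sub-Gaussian, this is at most \<open>exp (4 * \<Sum>i. (a i)\<^sup>2)\<close> once \<open>\<Sum>i. (a i)\<^sup>2\<close> is small, and
  \<open>\<Sum>i. (a i)\<^sup>2\<close> is a constant times \<open>(\<parallel>\<theta>\<parallel> * \<bar>\<mu>\<^sub>2(P)\<bar>)\<^sup>2\<close>, which tends to zero.
\<close>

section \<open>Sums over graphs without leaves\<close>

text \<open>
  The expectation of \<open>g (R 0, \<dots>, R (n - 1))\<close> for independent \<open>R i\<close> equal to \<open>2\<close> with probability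
  \<open>1/3\<close> and to \<open>- 1\<close> with probability \<open>2/3\<close>. It is defined as an iterated average, with the last
  variable innermost, because the induction in \<open>skew_mean_exp_square\<close> integrates out one variable
  at a time.
\<close>
fun skew_mean :: "nat \<Rightarrow> ((nat \<Rightarrow> real) \<Rightarrow> real) \<Rightarrow> real" where
  "skew_mean 0 g = g (\<lambda>_. 0)"
| "skew_mean (Suc n) g = skew_mean n (\<lambda>r. (g (r(n := 2)) + 2 * g (r(n := - 1))) / 3)"

lemma skew_mean_sum: "skew_mean n (\<lambda>r. \<Sum>J\<in>X. c J * g J r) = (\<Sum>J\<in>X. c J * skew_mean n (g J))"
proof (induction n arbitrary: g)
  case (Suc n)
  have *: "(\<lambda>r. ((\<Sum>J\<in>X. c J * g J (r(n := 2))) + 2 * (\<Sum>J\<in>X. c J * g J (r(n := - 1)))) / 3)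
      = (\<lambda>r. \<Sum>J\<in>X. c J * ((g J (r(n := 2)) + 2 * g J (r(n := - 1))) / 3))"
    by (simp add: sum_distrib_left sum_divide_distrib flip: sum.distrib) (simp add: algebra_simps add_divide_distrib)
  show ?case by (simp only: skew_mean.simps * Suc)
qed simp

lemma skew_mean_mono:
  assumes "\<And>r. (\<And>i. i < n \<Longrightarrow> r i \<in> {2, - 1}) \<Longrightarrow> f r \<le> g r"
  shows "skew_mean n f \<le> skew_mean n g"
  using assms
proof (induction n arbitrary: f g)
  case (Suc n)
  have *: "(f (r(n := 2)) + 2 * f (r(n := - 1))) / 3 \<le> (g (r(n := 2)) + 2 * g (r(n := - 1))) / 3"
    if r: "\<And>i. i < n \<Longrightarrow> r i \<in> {2, - 1}" for r
  proof -
    have "f (r(n := x)) \<le> g (r(n := x))" if "x \<in> {2, - 1}" for x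
      using r that by (intro Suc.prems) (auto simp: less_Suc_eq)
    from this[of 2] this[of "- 1"] show ?thesis by simp
  qed
  show ?case unfolding skew_mean.simps by (intro Suc.IH *)
qed simp

lemma skew_mean_cmult: "skew_mean n (\<lambda>r. c * g r) = c * skew_mean n g"
  using skew_mean_sum[where X="{()}" and n=n and c="\<lambda>_. c" and g="\<lambda>_. g"] by simp

lemma skew_mean_prod:
  "skew_mean n (\<lambda>r. \<Prod>i<n. f i (r i)) = (\<Prod>i<n. (f i 2 + 2 * f i (- 1)) / 3)"
proof (induction n)
  case (Suc n)
  have "(\<Prod>i<n. f i ((r(n := x)) i)) = (\<Prod>i<n. f i (r i))" for r x
    by (rule prod.cong) auto
  then have *: "(\<lambda>r. ((\<Prod>i<Suc n. f i ((r(n := 2)) i)) + 2 * (\<Prod>i<Suc n. f i ((r(n := - 1)) i))) / 3)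
      = (\<lambda>r. ((f n 2 + 2 * f n (- 1)) / 3) * (\<Prod>i<n. f i (r i)))"
    by (auto simp: algebra_simps add_divide_distrib)
  show ?case by (simp only: skew_mean.simps * skew_mean_cmult Suc) simp
qed simp

text \<open>
  The choice of the distribution of \<open>R i\<close>: it is centred, and every other moment is at least \<open>1\<close>,
  so it dominates, moment by moment, a centred variable bounded by \<open>1\<close>. A symmetric variable would
  not do, since its odd moments vanish.
\<close>
lemma skew_moment_ge_1:
  assumes "k \<noteq> 1"
  shows "(2 ^ k + 2 * (- 1) ^ k) / 3 \<ge> (1 :: real)"
proof (cases "k = 0")
  case False
  with assms have "k \<ge> 2" by simp
  then obtain m where m: "k = m + 2" using le_Suc_ex by (metis add.commute)
  show ?thesis
  proof (cases "even k")
    case True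
    then have "(- 1 :: real) ^ k = 1" by simp
    moreover have "(2::real) ^ k \<ge> 1" by simp
    ultimately show ?thesis by simp
  next
    case False
    then have "m \<noteq> 0" using m by (metis add_0 even_numeral)
    then obtain l where "m = Suc l" using not0_implies_Suc by blast
    then have "(2::real) ^ k + 2 * (- 1) ^ k = 8 * 2 ^ l - 2" using m False by simp
    moreover have "(2::real) ^ l \<ge> 1" by simp
    ultimately have "(2::real) ^ k + 2 * (- 1) ^ k \<ge> 3" by linarith
    then show ?thesis by simp
  qed
qed simp

text \<open>
  Hoeffding's bound for a centred variable in an interval of length \<open>3\<close>; a negative \<open>l\<close> is the
  case of the reflected variable.
\<close>
lemma skew_exp_bound: "(exp (2 * l) + 2 * exp (- l)) / 3 \<le> exp (9 / 8 * l\<^sup>2 :: real)"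
proof (cases "l \<ge> 0")
  case True
  then have "1 + 1 / 3 * (exp (3 * l) - 1) > 0" by (simp add: field_simps add_pos_pos)
  moreover have "- (3 * l) * (1 / 3) + ln (1 + 1 / 3 * (exp (3 * l) - 1)) \<le> (3 * l)\<^sup>2 / 8"
    using True by (intro Hoeffdings_lemma_aux) auto
  ultimately have "exp (- l) * (1 + 1 / 3 * (exp (3 * l) - 1)) \<le> exp ((3 * l)\<^sup>2 / 8)"
    by (subst (asm) exp_le_cancel_iff[symmetric]) (simp add: exp_add exp_diff exp_minus field_simps)
  then show ?thesis by (simp add: field_simps power_mult_distrib flip: exp_add)
next
  case False
  then have "1 + 2 / 3 * (exp (- 3 * l) - 1) > 0" by (simp add: field_simps add_pos_pos)
  moreover have "- (- 3 * l) * (2 / 3) + ln (1 + 2 / 3 * (exp (- 3 * l) - 1)) \<le> (- 3 * l)\<^sup>2 / 8"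
    using False by (intro Hoeffdings_lemma_aux) auto
  ultimately have "exp (2 * l) * (1 + 2 / 3 * (exp (- 3 * l) - 1)) \<le> exp ((- 3 * l)\<^sup>2 / 8)"
    by (subst (asm) exp_le_cancel_iff[symmetric]) (simp add: exp_add field_simps)
  then show ?thesis by (simp add: field_simps power_mult_distrib flip: exp_add)
qed

text \<open>
  With \<open>W = \<Sum>i. a i * R i\<close>, integrating out one variable \<open>R\<close> with coefficient \<open>x\<close> turns
  \<open>exp (t * (w + x * R)\<^sup>2)\<close> into at most \<open>exp ((t + 5 * x\<^sup>2) * w\<^sup>2 + 4 * x\<^sup>2)\<close>: the cross term
  \<open>2 * t * x * w * R\<close> is controlled by Hoeffding's bound, which costs a multiple of
  \<open>t\<^sup>2 * x\<^sup>2 * w\<^sup>2\<close>, and \<open>R\<^sup>2 \<le> 4\<close>. The coefficient of the square thus grows only by a multiple of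
  \<open>\<Sum>i. (a i)\<^sup>2\<close> in total, which must keep it below \<open>1\<close>.
\<close>
lemma skew_mean_exp_square:
  assumes "0 \<le> t" "t + 5 * (\<Sum>i<n. (a i)\<^sup>2) \<le> 1"
  shows "skew_mean n (\<lambda>r. exp (t * (s + (\<Sum>i<n. a i * r i))\<^sup>2))
    \<le> exp ((t + 5 * (\<Sum>i<n. (a i)\<^sup>2)) * s\<^sup>2 + 4 * (\<Sum>i<n. (a i)\<^sup>2))"
  using assms
proof (induction n arbitrary: t)
  case (Suc n)
  define v where "v = (\<Sum>i<n. (a i)\<^sup>2)"
  define x where "x = a n"
  have v0: "v \<ge> 0" unfolding v_def by (simp add: sum_nonneg)
  have t: "0 \<le> t" "t + 5 * x\<^sup>2 + 5 * v \<le> 1" using Suc.prems by (auto simp: v_def x_def)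
  then have t1: "t \<le> 1" using v0 by (smt (verit) zero_le_power2)
  define W where "W = (\<lambda>r. s + (\<Sum>i<n. a i * r i))"
  have W: "s + (\<Sum>i<Suc n. a i * (r(n := y)) i) = W r + x * y" for r y
    by (auto simp: W_def x_def intro: sum.cong)
  have step: "(exp (t * (w + x * 2)\<^sup>2) + 2 * exp (t * (w + x * - 1)\<^sup>2)) / 3
      \<le> exp (4 * x\<^sup>2) * exp ((t + 5 * x\<^sup>2) * w\<^sup>2)" for w
  proof -
    have "exp (t * (w + x * 2)\<^sup>2) = exp (t * w\<^sup>2 + 4 * t * x\<^sup>2) * exp (2 * (2 * t * x * w))"
      by (simp add: power2_eq_square algebra_simps flip: exp_add)
    moreover have "exp (t * (w + x * - 1)\<^sup>2) \<le> exp (t * w\<^sup>2 + 4 * t * x\<^sup>2) * exp (- (2 * t * x * w))"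
      using t by (simp add: power2_eq_square algebra_simps flip: exp_add)
    ultimately have "(exp (t * (w + x * 2)\<^sup>2) + 2 * exp (t * (w + x * - 1)\<^sup>2)) / 3
      \<le> exp (t * w\<^sup>2 + 4 * t * x\<^sup>2) * ((exp (2 * (2 * t * x * w)) + 2 * exp (- (2 * t * x * w))) / 3)"
      by (simp add: field_simps)
    also have "\<dots> \<le> exp (t * w\<^sup>2 + 4 * t * x\<^sup>2) * exp (9 / 8 * (2 * t * x * w)\<^sup>2)"
      by (intro mult_left_mono skew_exp_bound) simp
    also have "\<dots> = exp (t * w\<^sup>2 + 4 * t * x\<^sup>2 + 9 / 8 * (2 * t * x * w)\<^sup>2)"
      by (simp flip: exp_add)
    also have "\<dots> \<le> exp (4 * x\<^sup>2 + (t + 5 * x\<^sup>2) * w\<^sup>2)"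
    proof -
      have "t\<^sup>2 \<le> 1" using t t1 by (simp add: power_le_one)
      then have "t\<^sup>2 * (x * w)\<^sup>2 \<le> 1 * (x * w)\<^sup>2" by (intro mult_right_mono) auto
      moreover have "4 * t * x\<^sup>2 \<le> 4 * x\<^sup>2" using t1 by (intro mult_right_mono) auto
      moreover have "(2 * t * x * w)\<^sup>2 = 4 * (t\<^sup>2 * (x * w)\<^sup>2)" by (simp add: power2_eq_square)
      moreover have "(x * w)\<^sup>2 \<ge> 0" by simp
      ultimately have "t * w\<^sup>2 + 4 * t * x\<^sup>2 + 9 / 8 * (2 * t * x * w)\<^sup>2 \<le> t * w\<^sup>2 + 4 * x\<^sup>2 + 5 * (x * w)\<^sup>2"
        by linarith
      then show ?thesis by (simp add: algebra_simps power_mult_distrib)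
    qed
    finally show ?thesis by (simp add: exp_add)
  qed
  have "skew_mean (Suc n) (\<lambda>r. exp (t * (s + (\<Sum>i<Suc n. a i * r i))\<^sup>2))
    = skew_mean n (\<lambda>r. (exp (t * (W r + x * 2)\<^sup>2) + 2 * exp (t * (W r + x * - 1)\<^sup>2)) / 3)"
    by (simp only: skew_mean.simps W)
  also have "\<dots> \<le> skew_mean n (\<lambda>r. exp (4 * x\<^sup>2) * exp ((t + 5 * x\<^sup>2) * (W r)\<^sup>2))"
    by (intro skew_mean_mono step)
  also have "\<dots> \<le> exp (4 * x\<^sup>2) * exp ((t + 5 * x\<^sup>2 + 5 * v) * s\<^sup>2 + 4 * v)"
    unfolding skew_mean_cmult W_def v_def
    by (intro mult_left_mono Suc.IH) (use t v_def in auto)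
  also have "\<dots> = exp ((t + 5 * (\<Sum>i<Suc n. (a i)\<^sup>2)) * s\<^sup>2 + 4 * (\<Sum>i<Suc n. (a i)\<^sup>2))"
    by (simp add: v_def x_def algebra_simps flip: exp_add)
  finally show ?case .
qed simp

definition pairs :: "nat \<Rightarrow> (nat \<times> nat) set" where
  "pairs n = {(i, j). i < j \<and> j < n}"

definition deg :: "(nat \<times> nat) set \<Rightarrow> nat \<Rightarrow> nat" where
  "deg J i = card {e \<in> J. fst e = i \<or> snd e = i}"

definition leafless :: "nat \<Rightarrow> (nat \<times> nat) set \<Rightarrow> bool" where
  "leafless n J \<longleftrightarrow> (\<forall>i<n. deg J i \<noteq> 1)"

lemma finite_pairs [simp]: "finite (pairs n)"
  by (rule finite_subset[of _ "{..<n} \<times> {..<n}"]) (auto simp: pairs_def)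

lemma prod_edges_eq_prod_degrees:
  fixes r :: "nat \<Rightarrow> real"
  assumes "J \<subseteq> pairs n"
  shows "(\<Prod>(i, j)\<in>J. r i * r j) = (\<Prod>i<n. r i ^ deg J i)"
proof -
  have fin: "finite J" using assms finite_subset by fastforce
  have "(\<Prod>(i, j)\<in>J. r i * r j) = (\<Prod>e\<in>J. \<Prod>i<n. if fst e = i \<or> snd e = i then r i else 1)"
  proof (rule prod.cong[OF refl])
    fix e assume "e \<in> J"
    then obtain i j where e: "e = (i, j)" "i < j" "j < n" using assms by (auto simp: pairs_def)
    have "(\<Prod>k<n. if i = k \<or> j = k then r k else 1) = (\<Prod>k\<in>{i, j}. r k)"
      using e by (intro prod.mono_neutral_cong_right) auto
    then show "(case e of (i, j) \<Rightarrow> r i * r j) = (\<Prod>k<n. if fst e = k \<or> snd e = k then r k else 1)"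
      using e by simp
  qed
  also have "\<dots> = (\<Prod>i<n. \<Prod>e\<in>J. if fst e = i \<or> snd e = i then r i else 1)"
    by (rule prod.swap)
  also have "\<dots> = (\<Prod>i<n. r i ^ deg J i)"
    by (simp add: deg_def fin flip: prod.inter_filter)
  finally show ?thesis .
qed

text \<open>
  By independence the mean of the product over the edges is the product over the vertices of the
  moments of order \<open>deg J i\<close>. A vertex of degree one makes it vanish, and every other vertex
  contributes a factor of at least one.
\<close>
lemma skew_mean_edges_ge:
  assumes "J \<subseteq> pairs n"
  shows "skew_mean n (\<lambda>r. \<Prod>(i, j)\<in>J. r i * r j) \<ge> of_bool (leafless n J)"
proof -
  have eq: "skew_mean n (\<lambda>r. \<Prod>(i, j)\<in>J. r i * r j)
      = (\<Prod>i<n. (2 ^ deg J i + 2 * (- 1) ^ deg J i) / 3)"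
    unfolding prod_edges_eq_prod_degrees[OF assms] by (rule skew_mean_prod)
  show ?thesis
  proof (cases "leafless n J")
    case True
    then show ?thesis unfolding eq
      by (auto simp: leafless_def intro!: prod_ge_1 skew_moment_ge_1[unfolded One_nat_def])
  next
    case False
    have "(2 ^ k + 2 * (- 1) ^ k) / 3 \<ge> (0 :: real)" for k :: nat
      by (cases "k = 1") (use skew_moment_ge_1[of k] in auto)
    with False show ?thesis unfolding eq by (auto intro!: prod_nonneg)
  qed
qed

lemma sum_edges_le_half_square:
  fixes x :: "nat \<Rightarrow> real"
  shows "(\<Sum>(i, j)\<in>pairs n. x i * x j) \<le> 1 / 2 * (\<Sum>i<n. x i)\<^sup>2"
proof (induction n)
  case (Suc n)
  have "pairs (Suc n) = pairs n \<union> (\<lambda>i. (i, n)) ` {..<n}"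
    by (auto simp: pairs_def less_Suc_eq)
  moreover have "pairs n \<inter> (\<lambda>i. (i, n)) ` {..<n} = {}" by (auto simp: pairs_def)
  ultimately have "(\<Sum>(i, j)\<in>pairs (Suc n). x i * x j)
      = (\<Sum>(i, j)\<in>pairs n. x i * x j) + (\<Sum>i<n. x i * x n)"
    by (simp add: sum.union_disjoint sum.reindex inj_on_def)
  moreover have "(\<Sum>i<Suc n. x i)\<^sup>2 = (\<Sum>i<n. x i)\<^sup>2 + 2 * (\<Sum>i<n. x i * x n) + (x n)\<^sup>2"
    by (simp add: power2_sum sum_distrib_left sum_distrib_right mult_ac)
  ultimately show ?case using Suc zero_le_power2[of "x n"] by linarith
qed (simp add: pairs_def)

text \<open>
  Replacing the indicator of leaflessness by the mean of \<open>\<Prod>(i, j)\<in>J. R i * R j\<close> makes the sum over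
  edge sets factorise: it becomes the mean of \<open>\<Prod>i<j. (1 + a i * a j * R i * R j)\<close>, which is at most
  the mean of \<open>exp (1/2 * (\<Sum>i. a i * R i)\<^sup>2)\<close>.
\<close>
lemma leafless_sum_le:
  fixes a :: "nat \<Rightarrow> real"
  assumes a: "\<And>i. a i \<ge> 0" and small: "10 * (\<Sum>i<n. (a i)\<^sup>2) \<le> 1"
  shows "(\<Sum>J\<in>Pow (pairs n). of_bool (leafless n J) * (\<Prod>(i, j)\<in>J. a i * a j))
    \<le> exp (4 * (\<Sum>i<n. (a i)\<^sup>2))"
proof -
  have "(\<Sum>J\<in>Pow (pairs n). of_bool (leafless n J) * (\<Prod>(i, j)\<in>J. a i * a j))
    \<le> (\<Sum>J\<in>Pow (pairs n). (\<Prod>(i, j)\<in>J. a i * a j) * skew_mean n (\<lambda>r. \<Prod>(i, j)\<in>J. r i * r j))"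
    using skew_mean_edges_ge
    by (intro sum_mono, subst mult.commute, intro mult_left_mono) (auto intro!: prod_nonneg mult_nonneg_nonneg a)
  also have "\<dots> = skew_mean n (\<lambda>r. \<Sum>J\<in>Pow (pairs n). (\<Prod>(i, j)\<in>J. a i * a j) * (\<Prod>(i, j)\<in>J. r i * r j))"
    by (rule skew_mean_sum[symmetric])
  also have "\<dots> \<le> skew_mean n (\<lambda>r. exp (1 / 2 * (0 + (\<Sum>i<n. a i * r i))\<^sup>2))"
  proof (rule skew_mean_mono)
    fix r :: "nat \<Rightarrow> real" assume r: "\<And>i. i < n \<Longrightarrow> r i \<in> {2, - 1}"
    let ?y = "\<lambda>(i, j). (a i * r i) * (a j * r j)"
    \<comment> \<open>The factors must be nonnegative before each is replaced by an exponential;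
        the most negative value of \<open>r i * r j\<close> is \<open>- 2\<close>.\<close>
    have nonneg: "0 \<le> 1 + ?y e" if e_in: "e \<in> pairs n" for e
    proof -
      obtain i j where e: "e = (i, j)" "i < n" "j < n" "i \<noteq> j" using e_in by (auto simp: pairs_def)
      have "r i * r j \<ge> - 2" using r[of i] r[of j] e by auto
      then have "(a i * a j) * (r i * r j) \<ge> (a i * a j) * (- 2)" by (intro mult_left_mono mult_nonneg_nonneg a)
      moreover have "2 * (a i * a j) \<le> (a i)\<^sup>2 + (a j)\<^sup>2" using sum_squares_bound[of "a i" "a j"] by (simp add: mult_ac)
      moreover have "(a i)\<^sup>2 + (a j)\<^sup>2 = (\<Sum>k\<in>{i, j}. (a k)\<^sup>2)" using e by simp
      moreover have "\<dots> \<le> (\<Sum>i<n. (a i)\<^sup>2)" using e by (intro sum_mono2) auto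
      ultimately have "0 \<le> 1 + (a i * a j) * (r i * r j)" using small by linarith
      also have "(a i * a j) * (r i * r j) = ?y e" using e by (simp only: prod.case mult_ac)
      finally show ?thesis .
    qed
    have "(\<Sum>J\<in>Pow (pairs n). (\<Prod>(i, j)\<in>J. a i * a j) * (\<Prod>(i, j)\<in>J. r i * r j))
        = (\<Sum>J\<in>Pow (pairs n). prod ?y J * (\<Prod>e\<in>pairs n - J. 1))"
      by (simp add: case_prod_unfold mult_ac flip: prod.distrib)
    also have "\<dots> = (\<Prod>e\<in>pairs n. ?y e + 1)"
      by (rule prod_add[symmetric]) simp
    also have "\<dots> \<le> (\<Prod>e\<in>pairs n. exp (?y e))"
      using nonneg by (intro prod_mono) (auto simp: add.commute exp_ge_add_one_self)
    also have "\<dots> = exp (\<Sum>e\<in>pairs n. ?y e)" by (simp add: exp_sum)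
    also have "\<dots> \<le> exp (1 / 2 * (0 + (\<Sum>i<n. a i * r i))\<^sup>2)"
      using sum_edges_le_half_square[of "\<lambda>i. a i * r i" n] by simp
    finally show "(\<Sum>J\<in>Pow (pairs n). (\<Prod>(i, j)\<in>J. a i * a j) * (\<Prod>(i, j)\<in>J. r i * r j)) \<le> \<dots>" .
  qed
  also have "\<dots> \<le> exp ((1 / 2 + 5 * (\<Sum>i<n. (a i)\<^sup>2)) * 0\<^sup>2 + 4 * (\<Sum>i<n. (a i)\<^sup>2))"
    by (rule skew_mean_exp_square) (use small in auto)
  finally show ?thesis by simp
qed

section \<open>Symmetric matrices and the centred form\<close>

text \<open>
  Otherwise moving from \<open>e\<close> a little in the direction \<open>- A e\<close> changes the form by a negative
  first-order term and a second-order one, so the form would become negative.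
\<close>
lemma psd_zero_kernel:
  fixes A :: "'a::real_inner \<Rightarrow> 'a"
  assumes lin: "linear A" and V: "subspace V" and inv: "\<And>u. u \<in> V \<Longrightarrow> A u \<in> V"
    and sym: "\<And>u w. u \<bullet> A w = A u \<bullet> w"
    and psd: "\<And>u. u \<in> V \<Longrightarrow> 0 \<le> u \<bullet> A u"
    and e: "e \<in> V" "e \<bullet> A e = 0"
  shows "A e = 0"
proof (rule ccontr)
  assume "A e \<noteq> 0"
  define g where "g = A e \<bullet> A e"
  define q where "q = A e \<bullet> A (A e)"
  have g: "g > 0" using \<open>A e \<noteq> 0\<close> by (simp add: g_def)
  have q: "q \<ge> 0" unfolding q_def using e inv by (intro psd) auto
  define t where "t = g / (q + 1)"
  have t: "t > 0" using g q by (simp add: t_def)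
  have "e - t *\<^sub>R A e \<in> V" using e inv V by (simp add: subspace_diff subspace_scale)
  then have "0 \<le> (e - t *\<^sub>R A e) \<bullet> A (e - t *\<^sub>R A e)" by (rule psd)
  also have "\<dots> = - 2 * t * g + t\<^sup>2 * q"
    using e(2) sym[of e "A e"]
    by (simp add: linear_diff[OF lin] linear_scale[OF lin] inner_diff_left inner_diff_right g_def q_def
        power2_eq_square inner_commute algebra_simps)
  also have "\<dots> = t * (t * q - 2 * g)" by (simp add: power2_eq_square algebra_simps)
  also have "t * q \<le> g" using g q by (simp add: t_def field_simps)
  then have "t * q - 2 * g < 0" using g by linarith
  then have "t * (t * q - 2 * g) < 0" using t by (simp add: mult_pos_neg)
  finally show False by simp
qed

lemma quadratic_form_le_of_unit:
  fixes A :: "'a::real_inner \<Rightarrow> 'a"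
  assumes lin: "linear A" and V: "subspace V"
    and b: "\<And>u. u \<in> V \<Longrightarrow> norm u = 1 \<Longrightarrow> \<bar>u \<bullet> A u\<bar> \<le> b" and u: "u \<in> V"
  shows "\<bar>u \<bullet> A u\<bar> \<le> b * (u \<bullet> u)"
proof (cases "u = 0")
  case False
  define c where "c = 1 / norm u"
  have "norm (c *\<^sub>R u) = 1" using False by (simp add: c_def)
  then have "\<bar>(c *\<^sub>R u) \<bullet> A (c *\<^sub>R u)\<bar> \<le> b"
    using V u by (intro b) (auto simp: subspace_scale)
  then have "c\<^sup>2 * \<bar>u \<bullet> A u\<bar> \<le> b"
    by (simp add: linear_scale[OF lin] power2_eq_square abs_mult)
  then show ?thesis using False by (simp add: c_def field_simps power2_norm_eq_inner)
qed (simp add: linear_0[OF lin])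

text \<open>
  If \<open>f\<close> maximises \<open>\<bar>u \<bullet> A u\<bar>\<close> on the unit sphere of \<open>V\<close> and \<open>\<nu> = f \<bullet> A f\<close>, then
  one of \<open>\<bar>\<nu>\<bar> I - A\<close> and \<open>\<bar>\<nu>\<bar> I + A\<close>, according to the sign of \<open>\<nu>\<close>, is positive semidefinite on \<open>V\<close>
  with a quadratic form that vanishes at \<open>f\<close>.
\<close>
lemma extremal_eigenvector:
  fixes A :: "'a::euclidean_space \<Rightarrow> 'a"
  assumes lin: "linear A" and V: "subspace V" and inv: "\<And>u. u \<in> V \<Longrightarrow> A u \<in> V"
    and sym: "\<And>u w. u \<bullet> A w = A u \<bullet> w"
    and f: "f \<in> V" "norm f = 1"
    and max: "\<And>u. u \<in> V \<Longrightarrow> norm u = 1 \<Longrightarrow> \<bar>u \<bullet> A u\<bar> \<le> \<bar>f \<bullet> A f\<bar>"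
  shows "A f = (f \<bullet> A f) *\<^sub>R f"
proof -
  define \<nu> where "\<nu> = f \<bullet> A f"
  \<comment> \<open>A sign with \<open>s * \<nu> = \<bar>\<nu>\<bar>\<close>, so that maxima and minima of the form are treated alike.\<close>
  define s where "s = (if \<nu> \<ge> 0 then 1 else - 1 :: real)"
  have s: "s * \<nu> = \<bar>\<nu>\<bar>" "s * s = 1" by (auto simp: s_def)
  have bound: "s * (u \<bullet> A u) \<le> \<bar>\<nu>\<bar> * (u \<bullet> u)" if u: "u \<in> V" for u
    using quadratic_form_le_of_unit[OF lin V max u] by (auto simp: s_def \<nu>_def)
  define B where "B = (\<lambda>u. \<bar>\<nu>\<bar> *\<^sub>R u - s *\<^sub>R A u)"
  have "linear B" unfolding B_def
    by (intro linear_compose_sub linear_compose_scale_right lin linear_ident)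
  moreover have "B u \<in> V" if "u \<in> V" for u
    using that V inv by (simp add: B_def subspace_diff subspace_scale)
  moreover have "u \<bullet> B w = B u \<bullet> w" for u w
    by (simp add: B_def inner_diff_left inner_diff_right sym)
  moreover have "0 \<le> u \<bullet> B u" if "u \<in> V" for u
    using bound[OF that] by (simp add: B_def inner_diff_right)
  moreover have "f \<bullet> B f = 0"
    using f(2) s by (simp add: B_def inner_diff_right norm_eq_1 flip: \<nu>_def)
  ultimately have "B f = 0" using psd_zero_kernel[of B V f] V f(1) by blast
  then have "s *\<^sub>R A f = (s * \<nu>) *\<^sub>R f" by (simp add: B_def s)
  then have "s *\<^sub>R (s *\<^sub>R A f) = s *\<^sub>R ((s * \<nu>) *\<^sub>R f)" by simp
  then show ?thesis using s(2) by (simp add: \<nu>_def flip: mult.assoc)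
qed

text \<open>
  Polarisation together with the parallelogram law.
\<close>
lemma form_le_of_quadratic_form_le:
  fixes A :: "'a::real_inner \<Rightarrow> 'a"
  assumes lin: "linear A" and V: "subspace V"
    and sym: "\<And>u w. u \<bullet> A w = A u \<bullet> w"
    and b: "\<And>u. u \<in> V \<Longrightarrow> norm u = 1 \<Longrightarrow> \<bar>u \<bullet> A u\<bar> \<le> b"
    and uw: "u \<in> V" "w \<in> V"
  shows "\<bar>u \<bullet> A w\<bar> \<le> b * norm u * norm w"
proof -
  have quad: "\<bar>u \<bullet> A u\<bar> \<le> b * (norm u)\<^sup>2" if "u \<in> V" for u
    using quadratic_form_le_of_unit[OF lin V b that] by (simp add: power2_norm_eq_inner)
  have unit: "\<bar>x \<bullet> A y\<bar> \<le> b" if "x \<in> V" "y \<in> V" "norm x = 1" "norm y = 1" for x y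
  proof -
    have "4 * (x \<bullet> A y) = (x + y) \<bullet> A (x + y) - (x - y) \<bullet> A (x - y)"
      using sym[of x y] by (simp add: linear_add[OF lin] linear_diff[OF lin] inner_add_left inner_add_right
          inner_diff_left inner_diff_right inner_commute)
    moreover have "\<bar>(x + y) \<bullet> A (x + y)\<bar> \<le> b * (norm (x + y))\<^sup>2" "\<bar>(x - y) \<bullet> A (x - y)\<bar> \<le> b * (norm (x - y))\<^sup>2"
      using that V by (auto intro!: quad simp: subspace_add subspace_diff)
    moreover have "(norm (x + y))\<^sup>2 + (norm (x - y))\<^sup>2 = 4"
      using that by (simp add: power2_norm_eq_inner norm_eq_1 inner_add_left inner_add_right inner_diff_left inner_diff_right)
    then have "b * (norm (x + y))\<^sup>2 + b * (norm (x - y))\<^sup>2 = 4 * b"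
      by (metis distrib_left mult.commute)
    ultimately show ?thesis by linarith
  qed
  show ?thesis
  proof (cases "u = 0 \<or> w = 0")
    case True
    then show ?thesis by (auto simp: linear_0[OF lin])
  next
    case False
    have "\<bar>((1 / norm u) *\<^sub>R u) \<bullet> A ((1 / norm w) *\<^sub>R w)\<bar> \<le> b"
      using False uw V by (intro unit) (auto simp: subspace_scale)
    then show ?thesis using False by (simp add: linear_scale[OF lin] abs_mult field_simps)
  qed
qed

lemma quadratic_form_attains_max:
  fixes A :: "'a::euclidean_space \<Rightarrow> 'a"
  assumes lin: "linear A" and V: "subspace V" "V \<noteq> {0}"
  obtains f where "f \<in> V" "norm f = 1" "\<And>u. u \<in> V \<Longrightarrow> norm u = 1 \<Longrightarrow> \<bar>u \<bullet> A u\<bar> \<le> \<bar>f \<bullet> A f\<bar>"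
proof -
  obtain z where z: "z \<in> V" "z \<noteq> 0" using V subspace_0 by blast
  have "(1 / norm z) *\<^sub>R z \<in> V \<inter> sphere 0 1"
    using z V by (simp add: subspace_scale)
  moreover have "compact (V \<inter> sphere 0 1)"
    using closed_subspace[OF V(1)] by (simp add: closed_Int_compact)
  moreover have "continuous_on (V \<inter> sphere 0 1) (\<lambda>u. \<bar>u \<bullet> A u\<bar>)"
    using linear_continuous_on[OF linear_conv_bounded_linear[THEN iffD1, OF lin]]
    by (intro continuous_intros)
  ultimately obtain f where "f \<in> V \<inter> sphere 0 1" "\<forall>u\<in>V \<inter> sphere 0 1. \<bar>u \<bullet> A u\<bar> \<le> \<bar>f \<bullet> A f\<bar>"
    using continuous_attains_sup[of "V \<inter> sphere 0 1" "\<lambda>u. \<bar>u \<bullet> A u\<bar>"] by blast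
  then show ?thesis by (intro that[of f]) auto
qed

lemma poly_det: "poly (det M) x = det (\<chi> i j. poly (M $ i $ j) x)"
  for M :: "'a::comm_ring_1 poly ^ 'n ^ 'n"
  by (simp add: det_def poly_sum poly_prod of_int_poly)

text \<open>
  A real number above the operator norm is not an eigenvalue.
\<close>
lemma charpoly_nz:
  fixes M :: "real ^ 'k ^ 'k"
  shows "charpoly M \<noteq> 0"
proof -
  define x where "x = onorm ((*v) M) + 1"
  have bl: "bounded_linear ((*v) M)" by (rule matrix_vector_mul_bounded_linear)
  have eq: "poly (charpoly M) x = det (mat x - M)"
    unfolding charpoly_def poly_det by (rule arg_cong[where f = det]) (simp add: vec_eq_iff mat_def map_matrix_def)
  have "v = 0" if v: "(mat x - M) *v v = 0" for v
  proof (rule ccontr)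
    assume "v \<noteq> 0"
    have "mat x *v v = x *\<^sub>R v" by (simp add: vec_eq_iff mat_def matrix_vector_mult_def if_distrib[of "\<lambda>a. a * _"] cong: if_cong)
    then have "x *\<^sub>R v = M *v v" using v by (simp add: matrix_vector_mult_diff_rdistrib)
    then have "x * norm v \<le> onorm ((*v) M) * norm v"
      using onorm[OF bl, of v] onorm_pos_le[OF bl] by (metis abs_of_nonneg add_increasing2 norm_scaleR x_def zero_le_one)
    then show False using \<open>v \<noteq> 0\<close> by (simp add: x_def)
  qed
  then have "invertible (mat x - M)"
    by (metis invertible_left_inverse matrix_left_invertible_ker)
  then have "det (mat x - M) \<noteq> 0" by (simp add: invertible_det_nz)
  with eq show ?thesis by auto
qed

lemma det_rows_mul2:
  fixes M :: "'a::comm_ring_1 ^ 'n ^ 'n"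
  assumes "p \<noteq> q" "\<And>j. M $ p $ j = c * N $ p $ j" "\<And>j. M $ q $ j = d * N $ q $ j"
    "\<And>i j. i \<noteq> p \<Longrightarrow> i \<noteq> q \<Longrightarrow> M $ i $ j = N $ i $ j"
  shows "det M = c * d * det N"
proof -
  have "M = (\<chi> i. (if i = p then c else if i = q then d else 1) *s N $ i)"
    using assms by (auto simp: vec_eq_iff)
  then have "det M = (\<Prod>i\<in>UNIV. if i = p then c else if i = q then d else 1) * det N"
    using det_rows_mul[of "\<lambda>i. if i = p then c else if i = q then d else 1" "\<lambda>i. N $ i"] by simp
  also have "(\<Prod>i\<in>UNIV. if i = p then c else if i = q then d else 1) = (\<Prod>i\<in>{p, q}. if i = p then c else if i = q then d else 1)"
    by (rule prod.mono_neutral_right) auto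
  finally show ?thesis using assms(1) by simp
qed

text \<open>
  Multiplicities matter here, since \<open>\<mu> = \<nu>\<close> is possible. Extend \<open>e, f\<close> to a basis and let \<open>Q\<close> be
  the matrix with these rows; in \<open>Q (X I - M)\<close> the rows of \<open>e\<close> and \<open>f\<close> are \<open>(X - \<mu>) e\<close> and
  \<open>(X - \<nu>) f\<close>, so both linear factors can be pulled out of its determinant
  \<open>det Q * charpoly M\<close>.
\<close>
lemma two_eigenvectors_charpoly:
  fixes M :: "real ^ 'k ^ 'k"
  assumes ind: "independent {e, f}" "e \<noteq> f"
    and eig: "e v* M = \<mu> *\<^sub>R e" "f v* M = \<nu> *\<^sub>R f"
  shows "[:- \<mu>, 1:] * [:- \<nu>, 1:] dvd charpoly M"
proof -
  obtain B where B: "{e, f} \<subseteq> B" "independent B" "UNIV \<subseteq> span B"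
    using maximal_independent_subset_extend[OF _ ind(1), of UNIV] by auto
  have "finite B" "card B = CARD('k)"
    using B basis_card_eq_dim[of B UNIV] by (auto simp: independent_imp_finite)
  then obtain g :: "'k \<Rightarrow> real ^ 'k" where g: "bij_betw g UNIV B"
    by (metis finite_class.finite_UNIV finite_same_card_bij)
  then have "range g = B" by (simp add: bij_betw_def)
  then obtain p q where pq: "g p = e" "g q = f" using B(1) by (metis imageE insert_subset)
  define Q :: "real ^ 'k ^ 'k" where "Q = (\<chi> i. g i)"
  have rows: "rows Q = B" using g by (auto simp: rows_def row_def Q_def bij_betw_def vec_nth_inverse)
  have "span (rows Q) = UNIV" using B(3) rows by auto
  then have "invertible Q"
    by (simp add: invertible_left_inverse matrix_left_invertible_span_rows)
  then have "det Q \<noteq> 0" by (simp add: invertible_det_nz)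
  define X :: "real poly ^ 'k ^ 'k" where "X = mat [:0, 1:] - map_matrix (\<lambda>c. [:c:]) M"
  define QX :: "real poly ^ 'k ^ 'k" where "QX = map_matrix (\<lambda>c. [:c:]) Q"
  have detQX: "det QX = [:det Q:]"
  proof -
    have "poly (det QX) x = poly [:det Q:] x" for x
      by (simp add: poly_det QX_def)
    then show ?thesis using poly_eq_poly_eq_iff by blast
  qed
  define N :: "real poly ^ 'k ^ 'k" where
    "N = (\<chi> i j. if i = p \<or> i = q then QX $ i $ j else (QX ** X) $ i $ j)"
  have row: "(QX ** X) $ i $ j = [:- c, 1:] * QX $ i $ j" if "g i v* M = c *\<^sub>R g i" for i j c
  proof -
    have "(\<Sum>k\<in>UNIV. g i $ k * M $ k $ j) = c * g i $ j"
      using arg_cong[OF that, of "\<lambda>v. v $ j"] by (simp add: vector_matrix_mult_def mult.commute)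
    then have "poly ((QX ** X) $ i $ j) x = poly ([:- c, 1:] * QX $ i $ j) x" for x
      by (simp add: matrix_matrix_mult_def QX_def X_def Q_def mat_def poly_sum right_diff_distrib sum_subtractf
          if_distrib[of "\<lambda>p. poly p x"] if_distrib[of "\<lambda>a. _ * a"] algebra_simps cong: if_cong)
    then show ?thesis using poly_eq_poly_eq_iff by blast
  qed
  have row_p: "(QX ** X) $ p $ j = [:- \<mu>, 1:] * QX $ p $ j"
    and row_q: "(QX ** X) $ q $ j = [:- \<nu>, 1:] * QX $ q $ j" for j
    using eig pq by (auto intro!: row simp del: mult_pCons_left)
  have "det (QX ** X) = [:- \<mu>, 1:] * [:- \<nu>, 1:] * det N"
    by (rule det_rows_mul2[of p q]) (use pq ind in \<open>auto simp: N_def row_p row_q simp del: mult_pCons_left\<close>)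
  then have "[:det Q:] * charpoly M = [:- \<mu>, 1:] * [:- \<nu>, 1:] * det N"
    unfolding det_mul detQX charpoly_def X_def[symmetric] .
  then have "[:- \<mu>, 1:] * [:- \<nu>, 1:] dvd [:det Q:] * charpoly M"
    by (metis dvd_triv_left)
  moreover have "[:det Q:] * charpoly M = smult (det Q) (charpoly M)" by simp
  ultimately show ?thesis using \<open>det Q \<noteq> 0\<close> by (metis dvd_smult_iff)
qed

lemma snd_largest_ge:
  fixes xs :: "real list"
  assumes "{#\<mu>, \<nu>#} \<subseteq># mset xs" "\<bar>\<nu>\<bar> \<le> \<bar>\<mu>\<bar>"
  shows "\<bar>\<nu>\<bar> \<le> \<bar>sort_key (\<lambda>x. - \<bar>x\<bar>) xs ! 1\<bar>"
proof -
  define ys where "ys = sort_key (\<lambda>x. - \<bar>x\<bar>) xs"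
  have ys: "{#\<mu>, \<nu>#} \<subseteq># mset ys" "sorted (map (\<lambda>x. - \<bar>x\<bar>) ys)"
    using assms by (simp_all add: ys_def)
  have "length ys \<ge> 2" using size_mset_mono[OF ys(1)] by simp
  then obtain y0 y1 zs where y: "ys = y0 # y1 # zs"
    by (metis Suc_le_length_iff numeral_2_eq_2)
  show ?thesis
  proof (rule ccontr)
    assume "\<not> ?thesis"
    then have "\<bar>y1\<bar> < \<bar>\<nu>\<bar>" by (simp add: y flip: ys_def)
    then have small: "\<bar>z\<bar> < \<bar>\<nu>\<bar>" if "z \<in># mset (y1 # zs)" for z
      using that ys(2) by (auto simp: y)
    have "\<mu> \<notin># mset (y1 # zs)" "\<nu> \<notin># mset (y1 # zs)" using small assms(2) by fastforce+
    moreover have "\<mu> \<in># mset ys" "\<nu> \<in># mset ys" using ys(1) by (auto dest: mset_subset_eqD)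
    ultimately have "\<mu> = y0" "\<nu> = y0" by (auto simp: y)
    then have "{#y0#} \<subseteq># mset (y1 # zs)" using ys(1) by (simp add: y)
    then show False using \<open>\<nu> \<notin># mset (y1 # zs)\<close> \<open>\<nu> = y0\<close> by simp
  qed
qed

text \<open>
  The nonnegativity of \<open>e\<close> is the Perron-Frobenius property: passing from \<open>u\<close> to its entrywise
  absolute value can only increase the form of a nonnegative matrix, so the extremal vector may be
  taken nonnegative. With its eigenvalue \<open>\<mu>\<close>, the form splits into the part along \<open>e\<close> and the part
  on the orthogonal complement of \<open>e\<close>. The latter is governed by an extremal eigenvalue \<open>\<nu>\<close> there,
  and \<open>\<mu>, \<nu>\<close> are two roots of the characteristic polynomial with \<open>\<bar>\<nu>\<bar> \<le> \<bar>\<mu>\<bar>\<close>, so \<open>\<bar>\<nu>\<bar>\<close> is at most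
  the second largest magnitude.
\<close>
lemma near_rank_one:
  fixes P :: "real ^ 'k ^ 'k"
  assumes K: "CARD('k) > 1" and sym: "transpose P = P" and nonneg: "\<And>k l. P $ k $ l \<ge> 0"
  obtains e :: "real ^ 'k" and \<mu> where "\<And>k. e $ k \<ge> 0"
    "\<And>u w. \<bar>u \<bullet> (P *v w) - \<mu> * (u \<bullet> e) * (e \<bullet> w)\<bar> \<le> \<bar>eigval_mag 2 P\<bar> * norm u * norm w"
proof -
  have lin: "linear ((*v) P)" by simp
  have symP: "u \<bullet> (P *v w) = (P *v u) \<bullet> w" for u w
    using dot_lmul_matrix[of u P w] sym by (metis transpose_matrix_vector)
  obtain u0 where u0: "norm u0 = 1" "\<And>u. norm u = 1 \<Longrightarrow> \<bar>u \<bullet> (P *v u)\<bar> \<le> \<bar>u0 \<bullet> (P *v u0)\<bar>"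
    using quadratic_form_attains_max[OF lin, of UNIV] UNIV_not_singleton by (auto simp: subspace_UNIV)
  define e where "e = (\<chi> k. \<bar>u0 $ k\<bar>)"
  have e_nonneg: "e $ k \<ge> 0" for k by (simp add: e_def)
  have e1: "norm e = 1" using u0(1) by (simp add: e_def norm_vec_def)
  have "\<bar>u0 \<bullet> (P *v u0)\<bar> \<le> e \<bullet> (P *v e)"
    unfolding inner_vec_def matrix_vector_mult_def
    by (auto simp: e_def sum_distrib_left abs_mult nonneg intro!: order_trans[OF sum_abs] sum_mono)
  then have max_e: "\<bar>u \<bullet> (P *v u)\<bar> \<le> \<bar>e \<bullet> (P *v e)\<bar>" if "norm u = 1" for u
    using u0(2)[OF that] by linarith
  define \<mu> where "\<mu> = e \<bullet> (P *v e)"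
  have eig_e: "P *v e = \<mu> *\<^sub>R e"
    unfolding \<mu>_def by (rule extremal_eigenvector[OF lin, of UNIV]) (use symP e1 max_e in \<open>auto simp: subspace_UNIV\<close>)
  define V where "V = {u. u \<bullet> e = 0}"
  have V: "subspace V" by (auto simp: V_def subspace_def inner_add_left)
  have inv: "P *v u \<in> V" if "u \<in> V" for u
    using that symP[of u e] by (simp add: V_def eig_e)
  have "V \<noteq> {0}"
  proof
    assume "V = {0}"
    have "dim V = CARD('k) - 1"
      using dim_hyperplane[of e] e1 by (force simp: V_def inner_commute)
    with \<open>V = {0}\<close> K show False by simp
  qed
  then obtain f where f: "f \<in> V" "norm f = 1" "\<And>u. u \<in> V \<Longrightarrow> norm u = 1 \<Longrightarrow> \<bar>u \<bullet> (P *v u)\<bar> \<le> \<bar>f \<bullet> (P *v f)\<bar>"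
    using quadratic_form_attains_max[OF lin V] by blast
  define \<nu> where "\<nu> = f \<bullet> (P *v f)"
  have eig_f: "P *v f = \<nu> *\<^sub>R f"
    unfolding \<nu>_def by (rule extremal_eigenvector[OF lin V inv symP f])
  have ef: "f \<bullet> e = 0" "e \<noteq> f" using f e1 by (auto simp: V_def norm_eq_1)
  have "independent {e, f}"
    using ef e1 f(2) by (intro pairwise_orthogonal_independent) (auto simp: pairwise_def orthogonal_def inner_commute)
  moreover have "e v* P = \<mu> *\<^sub>R e" "f v* P = \<nu> *\<^sub>R f"
    using eig_e eig_f sym by (metis transpose_matrix_vector)+
  ultimately have dvd: "[:- \<mu>, 1:] * [:- \<nu>, 1:] dvd charpoly P"
    using ef(2) by (intro two_eigenvectors_charpoly)
  then obtain q where q: "charpoly P = [:- \<mu>, 1:] * [:- \<nu>, 1:] * q" by blast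
  have "proots (charpoly P) = proots ([:- \<mu>, 1:] * [:- \<nu>, 1:]) + proots q"
    using charpoly_nz[of P] unfolding q by (intro proots_mult) auto
  also have "proots ([:- \<mu>, 1:] * [:- \<nu>, 1:]) = proots [:- \<mu>, 1:] + proots [:- \<nu>, 1:]"
    by (intro proots_mult) auto
  finally have "{#\<mu>, \<nu>#} \<subseteq># proots (charpoly P)" by simp
  moreover have "\<bar>\<nu>\<bar> \<le> \<bar>\<mu>\<bar>" using max_e[OF f(2)] by (simp add: \<mu>_def \<nu>_def)
  ultimately have \<nu>: "\<bar>\<nu>\<bar> \<le> \<bar>eigval_mag 2 P\<bar>"
    using snd_largest_ge[of \<mu> \<nu> "sorted_list_of_multiset (proots (charpoly P))"]
    by (simp add: eigval_mag_def eigvals_by_mag_def)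
  have "\<bar>u \<bullet> (P *v w) - \<mu> * (u \<bullet> e) * (e \<bullet> w)\<bar> \<le> \<bar>eigval_mag 2 P\<bar> * norm u * norm w" for u w
  proof -
    define pr where "pr = (\<lambda>u. u - (u \<bullet> e) *\<^sub>R e)"
    have ee: "e \<bullet> e = 1" using e1 by (simp add: norm_eq_1)
    have pr: "pr u \<in> V" for u by (simp add: V_def pr_def inner_diff_left ee)
    have norm_pr: "norm (pr u) \<le> norm u" for u
    proof -
      have "pr u \<bullet> pr u = u \<bullet> u - (u \<bullet> e)\<^sup>2"
        by (simp add: pr_def inner_diff_left inner_diff_right ee power2_eq_square inner_commute)
      then show ?thesis by (simp add: norm_le)
    qed
    have "pr u \<bullet> (P *v pr w) = u \<bullet> (P *v w) - \<mu> * (u \<bullet> e) * (e \<bullet> w)"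
      using symP[of e w] eig_e
      by (simp add: pr_def matrix_vector_mult_diff_distrib matrix_vector_mult_scaleR inner_diff_left inner_diff_right ee inner_commute)
    moreover have "\<bar>pr u \<bullet> (P *v pr w)\<bar> \<le> \<bar>\<nu>\<bar> * norm (pr u) * norm (pr w)"
      by (rule form_le_of_quadratic_form_le[OF lin V symP _ pr pr]) (use f(3) in \<open>simp add: \<nu>_def\<close>)
    moreover have "\<bar>\<nu>\<bar> * norm (pr u) * norm (pr w) \<le> \<bar>eigval_mag 2 P\<bar> * norm u * norm w"
      by (intro mult_mono \<nu> norm_pr) auto
    ultimately show ?thesis by linarith
  qed
  with e_nonneg show ?thesis by (rule that)
qed

definition centred_form :: "real ^ 'k ^ 'k \<Rightarrow> real ^ 'k ^ 'k \<Rightarrow> real ^ 'k \<Rightarrow> real ^ 'k \<Rightarrow> real ^ 'k \<Rightarrow> real" where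
  "centred_form P D h y z = (D *v (y - h)) \<bullet> (P *v (D *v (z - h)))"

lemma diag_mult_nth:
  fixes D :: "real ^ 'k ^ 'k"
  assumes "\<forall>k l. k \<noteq> l \<longrightarrow> D $ k $ l = 0"
  shows "(D *v x) $ k = D $ k $ k * x $ k"
proof -
  have "(D *v x) $ k = (\<Sum>l\<in>{k}. D $ k $ l * x $ l)"
    unfolding matrix_vector_mult_def vec_lambda_beta by (intro sum.mono_neutral_right) (use assms in auto)
  then show ?thesis by simp
qed

lemma norm_le_1_simplex: "x \<in> std_simplex \<Longrightarrow> norm x \<le> 1"
  using norm_le_l1_cart[of x] by (simp add: std_simplex_def)

lemma simplex_le_1:
  assumes "x \<in> std_simplex" shows "x $ k \<le> 1"
  using component_le_norm_cart[of x k] norm_le_1_simplex[OF assms] by linarith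

text \<open>
  With \<open>M = D P D\<close> the normalisation reads \<open>M h = 1\<close>, so \<open>x \<bullet> M h\<close> is the sum of the entries of \<open>x\<close>.
  Hence, for vectors whose entries sum to one, the degree effects cancel: the linear terms of the expansion of \<open>y \<bullet> M z\<close> around \<open>h\<close> are
  constant, and only the form in the centred vectors is left.
\<close>
lemma scaled_form_eq:
  assumes D: "diag_scaling P h D"
    and y: "(\<Sum>k\<in>UNIV. y $ k) = 1" and z: "(\<Sum>k\<in>UNIV. z $ k) = 1" and h: "(\<Sum>k\<in>UNIV. h $ k) = 1"
    and sym: "transpose P = P"
  shows "(D *v y) \<bullet> (P *v (D *v z)) = 1 + centred_form P D h y z"
    "(D *v (y - h)) \<bullet> (P *v (D *v h)) = 0"
proof -
  have diag: "\<forall>k l. k \<noteq> l \<longrightarrow> D $ k $ l = 0" using D by (simp add: diag_scaling_def)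
  have dot: "(D *v x) \<bullet> w = x \<bullet> (D *v w)" for x w
    by (simp add: inner_vec_def diag_mult_nth[OF diag] mult_ac)
  have symP: "u \<bullet> (P *v w) = (P *v u) \<bullet> w" for u w
    using dot_lmul_matrix[of u P w] sym by (metis transpose_matrix_vector)
  have one: "D *v (P *v (D *v h)) = 1"
    using D by (simp add: diag_scaling_def matrix_vector_mul_assoc matrix_mul_assoc)
  have *: "(D *v x) \<bullet> (P *v (D *v h)) = (\<Sum>k\<in>UNIV. x $ k)" for x
    unfolding dot one by (simp add: inner_vec_def)
  have **: "(D *v h) \<bullet> (P *v (D *v x)) = (\<Sum>k\<in>UNIV. x $ k)" for x
    unfolding symP by (subst inner_commute) (rule *)
  show "(D *v (y - h)) \<bullet> (P *v (D *v h)) = 0"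
    unfolding * using y h by (simp add: sum_subtractf)
  show "(D *v y) \<bullet> (P *v (D *v z)) = 1 + centred_form P D h y z"
    using *[of y] *[of h] **[of z] y z h
    by (simp add: centred_form_def matrix_vector_mult_diff_distrib inner_diff_left inner_diff_right)
qed

text \<open>
  Let \<open>u = D (y - h)\<close>, \<open>w = D (z - h)\<close>, \<open>v = D h\<close>. Up to an error controlled by the second eigenvalue,
  \<open>P\<close> is \<open>\<mu> e e'\<close>, and the possibly large part \<open>\<mu> (u \<bullet> e) (e \<bullet> w)\<close> must be shown to be small. Now
  \<open>u \<bullet> P v = 0\<close> forces \<open>\<mu> (u \<bullet> e) (e \<bullet> v)\<close> to be small, and \<open>\<bar>e \<bullet> w\<bar> \<le> (e \<bullet> v) / C\<close> because \<open>e\<close>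
  is nonnegative and the entries of \<open>z - h\<close> are at most \<open>1 \<le> h $ k / C\<close> in absolute value.
\<close>
lemma centred_form_le:
  fixes P D :: "real ^ 'k ^ 'k"
  assumes K: "CARD('k) > 1" and sym: "transpose P = P" and nonneg: "\<And>k l. P $ k $ l \<ge> 0"
    and one: "\<And>k. P $ k $ k = 1"
    and D: "diag_scaling P h D" and C: "C > 0" "\<And>k. h $ k \<ge> C"
    and simplex: "h \<in> std_simplex" "y \<in> std_simplex" "z \<in> std_simplex"
  shows "\<bar>centred_form P D h y z\<bar> \<le> \<bar>eigval_mag 2 P\<bar> * (4 / C + 2 / C\<^sup>2)"
proof -
  have diag: "\<forall>k l. k \<noteq> l \<longrightarrow> D $ k $ l = 0" and pos: "D $ k $ k > 0" for k
    using D by (auto simp: diag_scaling_def)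
  \<comment> \<open>The diagonal entry of \<open>P\<close> alone contributes \<open>(D $ k $ k)\<^sup>2 * h $ k\<close> to \<open>(D P D h) $ k = 1\<close>.\<close>
  have d2: "(D $ k $ k)\<^sup>2 \<le> 1 / C" for k
  proof -
    have "1 = (D *v (P *v (D *v h))) $ k"
      using D by (simp add: diag_scaling_def matrix_vector_mul_assoc matrix_mul_assoc)
    also have "\<dots> = D $ k $ k * (\<Sum>l\<in>UNIV. P $ k $ l * (D $ l $ l * h $ l))"
      by (simp add: diag_mult_nth[OF diag] matrix_vector_mult_def[of P])
    also have "\<dots> \<ge> D $ k $ k * (\<Sum>l\<in>{k}. P $ k $ l * (D $ l $ l * h $ l))"
      using pos nonneg simplex by (intro mult_left_mono sum_mono2) (auto intro!: mult_nonneg_nonneg less_imp_le[OF pos] simp: std_simplex_def)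
    also have "D $ k $ k * (\<Sum>l\<in>{k}. P $ k $ l * (D $ l $ l * h $ l)) = (D $ k $ k)\<^sup>2 * h $ k"
      by (simp add: one power2_eq_square)
    also have "\<dots> \<ge> (D $ k $ k)\<^sup>2 * C" by (intro mult_left_mono C) auto
    finally show ?thesis using C(1) by (simp add: field_simps)
  qed
  define s where "s = 1 / sqrt C"
  have s: "s > 0" "s * s = 1 / C" using C(1) by (auto simp: s_def)
  have dk: "D $ k $ k \<le> s" for k
    using real_le_rsqrt[OF d2[of k]] by (simp add: s_def real_sqrt_divide)
  have normD: "norm (D *v x) \<le> s * norm x" for x
  proof -
    have "norm (D *v x) \<le> norm (s *\<^sub>R x)"
      using dk pos s by (intro norm_le_componentwise_cart) (auto simp: diag_mult_nth[OF diag] abs_mult less_imp_le intro!: mult_right_mono)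
    then show ?thesis using s by simp
  qed
  define u w v where "u = D *v (y - h)" and "w = D *v (z - h)" and "v = D *v h"
  have le2: "norm (x - h) \<le> 2" if "x \<in> std_simplex" for x
    using norm_triangle_ineq4[of x h] norm_le_1_simplex[OF that] norm_le_1_simplex[OF simplex(1)] by linarith
  have u: "norm u \<le> s * 2" and w: "norm w \<le> s * 2" and v: "norm v \<le> s * 1"
    unfolding u_def w_def v_def using le2[OF simplex(2)] le2[OF simplex(3)] norm_le_1_simplex[OF simplex(1)] s
    by (auto intro!: order_trans[OF normD] mult_left_mono)
  obtain e :: "real ^ 'k" and \<mu> where e: "\<And>k. e $ k \<ge> 0" and
    r: "\<And>u w. \<bar>u \<bullet> (P *v w) - \<mu> * (u \<bullet> e) * (e \<bullet> w)\<bar> \<le> \<bar>eigval_mag 2 P\<bar> * norm u * norm w"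
    using near_rank_one[OF K sym nonneg] by metis
  define m where "m = \<bar>eigval_mag 2 P\<bar>"
  have ev: "e \<bullet> v \<ge> 0"
    using e pos simplex(1) by (auto simp: v_def inner_vec_def diag_mult_nth[OF diag] std_simplex_def less_imp_le intro!: sum_nonneg mult_nonneg_nonneg)
  have ew: "\<bar>e \<bullet> w\<bar> \<le> (e \<bullet> v) / C"
  proof -
    have "\<bar>e $ k * (D $ k $ k * (z $ k - h $ k))\<bar> \<le> e $ k * (D $ k $ k * h $ k) / C" for k
    proof -
      have "\<bar>z $ k - h $ k\<bar> \<le> 1"
        using simplex simplex_le_1[of z k] simplex_le_1[of h k] by (auto simp: std_simplex_def abs_le_iff) (smt (verit))+
      also have "1 \<le> h $ k / C" using C by (simp add: field_simps)
      finally have "e $ k * (D $ k $ k * \<bar>z $ k - h $ k\<bar>) \<le> e $ k * (D $ k $ k * (h $ k / C))"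
        using e pos by (intro mult_left_mono) (auto intro: less_imp_le)
      then show ?thesis using e[of k] pos[of k] by (simp add: abs_mult)
    qed
    then show ?thesis
      by (auto simp: w_def v_def inner_vec_def diag_mult_nth[OF diag] sum_divide_distrib intro!: order_trans[OF sum_abs] sum_mono)
  qed
  have sum1: "(\<Sum>k\<in>UNIV. x $ k) = 1" if "x \<in> std_simplex" for x :: "real ^ 'k"
    using that by (simp add: std_simplex_def)
  have uPv: "u \<bullet> (P *v v) = 0"
    unfolding u_def v_def using scaled_form_eq(2)[OF D sum1 sum1 sum1 sym] simplex by blast
  have "\<bar>\<mu> * (u \<bullet> e) * (e \<bullet> w)\<bar> \<le> \<bar>\<mu> * (u \<bullet> e)\<bar> * ((e \<bullet> v) / C)"
    unfolding abs_mult[of _ "e \<bullet> w"] by (intro mult_left_mono ew) auto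
  also have "\<dots> = \<bar>\<mu> * (u \<bullet> e) * (e \<bullet> v)\<bar> / C" using ev by (simp add: abs_mult)
  also have "\<dots> \<le> (m * norm u * norm v) / C"
    using r[of u v] uPv C(1) by (intro divide_right_mono) (auto simp: m_def)
  finally have "\<bar>u \<bullet> (P *v w)\<bar> \<le> m * norm u * norm w + m * norm u * norm v / C"
    using r[of u w] unfolding m_def by linarith
  also have "\<dots> \<le> m * (s * 2) * (s * 2) + m * (s * 2) * (s * 1) / C"
    using u v w s C(1) by (intro add_mono mult_mono divide_right_mono) (auto simp: m_def)
  also have "\<dots> = m * (4 * (s * s) + 2 * (s * s) / C)" by (simp add: algebra_simps)
  also have "\<dots> = m * (4 / C + 2 / C\<^sup>2)" unfolding s(2) by (simp add: power2_eq_square)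
  finally show ?thesis by (simp add: centred_form_def u_def w_def m_def)
qed

section \<open>The chi-squared distance to a mixture of graph models\<close>

text \<open>
  On a finite support the Radon-Nikodym derivative is the ratio of the point masses.
\<close>
lemma chi2_dist_pmf:
  assumes fin: "finite (set_pmf p)" and N: "finite_measure N" "sets N = UNIV"
    and null: "emeasure N (- set_pmf p) = 0"
  shows "chi2_dist (measure_pmf p) N = (\<Sum>x\<in>set_pmf p. (measure N {x})\<^sup>2 / pmf p x) - 1"
proof -
  interpret N: finite_measure N by fact
  define f where "f = (\<lambda>x. ennreal (measure N {x} / pmf p x))"
  have f: "f x * pmf p x = emeasure N {x}" if "x \<in> set_pmf p" for x
    using that by (simp add: f_def pmf_positive less_imp_neq N.emeasure_eq_measure flip: ennreal_mult')
      (metis less_irrefl pmf_positive)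
  have "density (measure_pmf p) f = N"
  proof (rule measure_eqI)
    fix X assume "X \<in> sets (density (measure_pmf p) f)"
    have "emeasure (density (measure_pmf p) f) X = (\<Sum>x\<in>set_pmf p. f x * indicator X x * pmf p x)"
      by (simp add: emeasure_density nn_integral_measure_pmf_finite[OF fin])
    also have "\<dots> = (\<Sum>x\<in>set_pmf p. emeasure N {x} * indicator X x)"
      using f by (intro sum.cong) (auto simp: indicator_def)
    also have "\<dots> = (\<Sum>x\<in>set_pmf p \<inter> X. emeasure N {x})"
      using fin by (intro sum.mono_neutral_cong_right) auto
    also have "\<dots> = emeasure N (set_pmf p \<inter> X)"
      using fin N by (intro emeasure_eq_sum_singleton[symmetric]) auto
    also have "\<dots> = emeasure N X"
    proof (rule emeasure_eq_AE)
      show "AE x in N. (x \<in> set_pmf p \<inter> X) = (x \<in> X)"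
        using null N by (intro AE_I[of _ _ "- set_pmf p"]) auto
    qed (use N in auto)
    finally show "emeasure (density (measure_pmf p) f) X = emeasure N X" .
  qed (simp add: N)
  then have "AE x in measure_pmf p. f x = RN_deriv (measure_pmf p) N x"
    by (intro measure_pmf.RN_deriv_unique) auto
  then have RN: "RN_deriv (measure_pmf p) N x = f x" if "x \<in> set_pmf p" for x
    using that by (simp add: AE_measure_pmf_iff)
  have "(\<integral>x. (enn2real (RN_deriv (measure_pmf p) N x))\<^sup>2 \<partial>measure_pmf p)
     = (\<Sum>x\<in>set_pmf p. (enn2real (RN_deriv (measure_pmf p) N x))\<^sup>2 * pmf p x)"
    by (intro integral_measure_pmf_real fin)
  also have "\<dots> = (\<Sum>x\<in>set_pmf p. (measure N {x})\<^sup>2 / pmf p x)"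
    by (intro sum.cong refl) (simp add: RN f_def power2_eq_square)
  finally show ?thesis by (simp add: chi2_dist_def)
qed

definition adj_of :: "(nat \<times> nat) set \<Rightarrow> nat \<Rightarrow> nat \<Rightarrow> nat" where
  "adj_of A i j = of_bool ((i, j) \<in> A \<or> (j, i) \<in> A)"

lemma inj_adj_of: "inj_on adj_of (Pow (pairs n))"
proof (rule inj_onI)
  fix A B assume AB: "A \<in> Pow (pairs n)" "B \<in> Pow (pairs n)" and eq: "adj_of A = adj_of B"
  have "(i, j) \<in> A \<or> (j, i) \<in> A \<longleftrightarrow> (i, j) \<in> B \<or> (j, i) \<in> B" for i j
    using fun_cong[OF fun_cong[OF eq, of i], of j] by (simp only: adj_of_def of_bool_eq_iff)
  moreover have "i < j" if "(i, j) \<in> A \<or> (i, j) \<in> B" for i j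
    using that AB by (auto simp: pairs_def)
  ultimately have "(i, j) \<in> A \<longleftrightarrow> (i, j) \<in> B" for i j by (metis less_asym)
  then show "A = B" by auto
qed

text \<open>
  The probability of the graph with edge set \<open>A\<close> when all entries of \<open>\<Omega>\<close> are probabilities. Unlike
  the mass function of the truncating Bernoulli law it is a polynomial in \<open>\<Omega>\<close>, so it can be expanded
  without side conditions.
\<close>
definition graph_weight :: "nat \<Rightarrow> (nat \<Rightarrow> nat \<Rightarrow> real) \<Rightarrow> (nat \<times> nat) set \<Rightarrow> real" where
  "graph_weight n \<Omega> A = (\<Prod>(i, j)\<in>A. \<Omega> i j) * (\<Prod>(i, j)\<in>pairs n - A. 1 - \<Omega> i j)"

lemma pmf_adj_of:
  assumes A: "A \<subseteq> pairs n"
  shows "pmf (adj_pmf n \<Omega>) (adj_of A) = (\<Prod>(i, j)\<in>pairs n. pmf (bernoulli_pmf (\<Omega> i j)) ((i, j) \<in> A))"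
proof -
  define M where "M = Pi_pmf (pairs n) False (\<lambda>(i, j). bernoulli_pmf (\<Omega> i j))"
  define T :: "(nat \<times> nat \<Rightarrow> bool) \<Rightarrow> nat \<Rightarrow> nat \<Rightarrow> nat" where
    "T = (\<lambda>e i j. of_bool (if i < j then e (i, j) else if j < i then e (j, i) else False))"
  have adj: "adj_pmf n \<Omega> = map_pmf T M" by (simp add: adj_pmf_def T_def M_def pairs_def)
  have "(T -` {adj_of A}) \<inter> set_pmf M = {\<lambda>e. e \<in> A} \<inter> set_pmf M"
  proof (intro set_eqI iffI; clarsimp)
    fix e assume e: "e \<in> set_pmf M" and T: "T e = adj_of A"
    have out: "\<not> e x" if "x \<notin> pairs n" for x
      using e that set_Pi_pmf_subset[OF finite_pairs] unfolding M_def by fastforce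
    show "e = (\<lambda>e. e \<in> A)"
    proof
      fix x show "e x = (x \<in> A)"
      proof (cases "x \<in> pairs n")
        case True
        then obtain i j where x: "x = (i, j)" "i < j" by (auto simp: pairs_def)
        then have "e (i, j) \<longleftrightarrow> (i, j) \<in> A \<or> (j, i) \<in> A"
          using fun_cong[OF fun_cong[OF T, of i], of j] by (simp only: T_def adj_of_def of_bool_eq_iff if_True)
        moreover have "(j, i) \<notin> A" using A x by (auto simp: pairs_def)
        ultimately show ?thesis using x by simp
      qed (use out A in auto)
    qed
  next
    show "T (\<lambda>e. e \<in> A) = adj_of A"
      using A by (intro ext) (auto simp: T_def adj_of_def pairs_def)
  qed
  then have "pmf (adj_pmf n \<Omega>) (adj_of A) = measure (measure_pmf M) {\<lambda>e. e \<in> A}"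
    unfolding adj pmf_map by (metis measure_Int_set_pmf)
  also have "\<dots> = (\<Prod>x\<in>pairs n. pmf ((\<lambda>(i, j). bernoulli_pmf (\<Omega> i j)) x) (x \<in> A))"
    unfolding M_def measure_pmf_single using A by (subst pmf_Pi') auto
  finally show ?thesis by (simp add: case_prod_unfold)
qed

lemma set_adj_pmf: "set_pmf (adj_pmf n \<Omega>) \<subseteq> adj_of ` Pow (pairs n)"
proof
  fix x assume "x \<in> set_pmf (adj_pmf n \<Omega>)"
  then obtain e where e: "e \<in> set_pmf (Pi_pmf (pairs n) False (\<lambda>(i, j). bernoulli_pmf (\<Omega> i j)))"
    and x: "x = (\<lambda>i j. of_bool (if i < j then e (i, j) else if j < i then e (j, i) else False))"
    by (auto simp: adj_pmf_def pairs_def)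
  have out: "\<not> e x" if "x \<notin> pairs n" for x
    using e that set_Pi_pmf_subset[OF finite_pairs] by fastforce
  have "x = adj_of {y. e y}"
    unfolding x by (intro ext) (use out in \<open>auto simp: adj_of_def pairs_def not_less_iff_gr_or_eq\<close>)
  moreover have "{y. e y} \<subseteq> pairs n" using out by auto
  ultimately show "x \<in> adj_of ` Pow (pairs n)" by blast
qed

lemma pmf_adj_of_eq_weight:
  assumes A: "A \<subseteq> pairs n" and \<Omega>: "edge_probs n \<Omega>"
  shows "pmf (adj_pmf n \<Omega>) (adj_of A) = graph_weight n \<Omega> A"
proof -
  have "pmf (adj_pmf n \<Omega>) (adj_of A) = (\<Prod>(i, j)\<in>pairs n. if (i, j) \<in> A then \<Omega> i j else 1 - \<Omega> i j)"
    unfolding pmf_adj_of[OF A] using \<Omega> by (intro prod.cong) (auto simp: edge_probs_def pairs_def)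
  also have "\<dots> = (\<Prod>x\<in>pairs n. if x \<in> A then case x of (i, j) \<Rightarrow> \<Omega> i j else case x of (i, j) \<Rightarrow> 1 - \<Omega> i j)"
    by (intro prod.cong) auto
  also have "\<dots> = graph_weight n \<Omega> A"
    using A by (subst prod.If_cases) (auto simp: graph_weight_def Int_absorb1 Diff_eq[symmetric] intro!: arg_cong2[of _ _ _ _ "(*)"] prod.cong)
  finally show ?thesis .
qed

lemma borel_measurable_pmf_bernoulli [measurable]:
  "(\<lambda>q. pmf (bernoulli_pmf q) b) \<in> borel_measurable borel"
proof -
  have "(\<lambda>q. pmf (bernoulli_pmf q) b) = (\<lambda>q. if b then min 1 (max 0 q) else 1 - min 1 (max 0 q))"
    by (simp add: bernoulli_pmf.rep_eq fun_eq_iff)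
  then show ?thesis by simp
qed

lemma adj_pmf_kernel_measurable:
  assumes [measurable]: "\<And>i j. i < j \<Longrightarrow> j < n \<Longrightarrow> (\<lambda>\<pi>. \<Omega> \<pi> i j) \<in> borel_measurable M"
  shows "(\<lambda>\<pi>. measure_pmf (adj_pmf n (\<Omega> \<pi>))) \<in> measurable M (subprob_algebra (count_space UNIV))"
proof (rule measurable_subprob_algebra)
  fix X :: "(nat \<Rightarrow> nat \<Rightarrow> nat) set"
  have [measurable]: "(\<lambda>\<pi>. pmf (bernoulli_pmf (\<Omega> \<pi> (fst e) (snd e))) b) \<in> borel_measurable M" if "e \<in> pairs n" for e b
    by (rule measurable_compose[OF assms borel_measurable_pmf_bernoulli]) (use that in \<open>auto simp: pairs_def\<close>)
  have "emeasure (adj_pmf n (\<Omega> \<pi>)) X = ennreal (\<Sum>x\<in>adj_of ` Pow (pairs n) \<inter> X. pmf (adj_pmf n (\<Omega> \<pi>)) x)" for \<pi>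
  proof -
    have "X \<inter> set_pmf (adj_pmf n (\<Omega> \<pi>)) = (adj_of ` Pow (pairs n) \<inter> X) \<inter> set_pmf (adj_pmf n (\<Omega> \<pi>))"
      using set_adj_pmf by blast
    then have "emeasure (adj_pmf n (\<Omega> \<pi>)) X = emeasure (adj_pmf n (\<Omega> \<pi>)) (adj_of ` Pow (pairs n) \<inter> X)"
      by (metis emeasure_Int_set_pmf)
    then show ?thesis by (simp add: emeasure_measure_pmf_finite)
  qed
  moreover have "(\<lambda>\<pi>. pmf (adj_pmf n (\<Omega> \<pi>)) x) \<in> borel_measurable M" if "x \<in> adj_of ` Pow (pairs n) \<inter> X" for x
    using that by (auto simp: pmf_adj_of case_prod_unfold intro!: borel_measurable_prod)
  ultimately show "(\<lambda>\<pi>. emeasure (adj_pmf n (\<Omega> \<pi>)) X) \<in> borel_measurable M"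
    by (simp add: borel_measurable_sum)
qed (auto intro: measure_pmf.subprob_space_axioms)

text \<open>
  Both sides are expansions of one product over the pairs, by the one-edge identity
  \<open>q q' / p + (1 - q) (1 - q') / (1 - p) = 1 + (q - p) (q' - p) / (p (1 - p))\<close>.
\<close>
lemma graph_weight_identity:
  assumes p: "\<And>i j. i < j \<Longrightarrow> j < n \<Longrightarrow> 0 < p i j \<and> p i j < 1"
  shows "(\<Sum>A\<in>Pow (pairs n). 1 / graph_weight n p A * (graph_weight n q A * graph_weight n q' A))
    = (\<Sum>J\<in>Pow (pairs n). 1 / (\<Prod>(i, j)\<in>J. p i j * (1 - p i j)) *
        ((\<Prod>(i, j)\<in>J. q i j - p i j) * (\<Prod>(i, j)\<in>J. q' i j - p i j)))"
    (is "?L = ?R")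
proof -
  have "?L = (\<Sum>A\<in>Pow (pairs n). (\<Prod>(i, j)\<in>A. q i j * q' i j / p i j) *
      (\<Prod>(i, j)\<in>pairs n - A. (1 - q i j) * (1 - q' i j) / (1 - p i j)))"
    by (simp add: graph_weight_def case_prod_unfold prod.distrib prod_dividef mult_ac)
  also have "\<dots> = (\<Prod>(i, j)\<in>pairs n. q i j * q' i j / p i j + (1 - q i j) * (1 - q' i j) / (1 - p i j))"
    unfolding case_prod_unfold by (rule prod_add[symmetric]) simp
  also have "\<dots> = (\<Prod>(i, j)\<in>pairs n. (q i j - p i j) * (q' i j - p i j) / (p i j * (1 - p i j)) + 1)"
  proof (intro prod.cong refl, clarsimp)
    fix i j assume "(i, j) \<in> pairs n"
    then have "p i j \<noteq> 0" "1 - p i j \<noteq> 0" using p[of i j] by (auto simp: pairs_def)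
    then show "q i j * q' i j / p i j + (1 - q i j) * (1 - q' i j) / (1 - p i j)
        = (q i j - p i j) * (q' i j - p i j) / (p i j * (1 - p i j)) + 1"
      by (simp add: divide_simps) (simp add: algebra_simps)
  qed
  also have "\<dots> = (\<Sum>J\<in>Pow (pairs n). (\<Prod>(i, j)\<in>J. (q i j - p i j) * (q' i j - p i j) / (p i j * (1 - p i j))) * (\<Prod>e\<in>pairs n - J. 1))"
    unfolding case_prod_unfold by (rule prod_add) simp
  also have "\<dots> = ?R"
    by (simp add: case_prod_unfold prod.distrib prod_dividef mult_ac)
  finally show ?thesis .
qed

text \<open>
  A square of an integral is a double integral of a product, so an identity between quadratic
  expressions in two independent copies can be integrated term by term.
\<close>
lemma sum_square_integrals:
  fixes f :: "'i \<Rightarrow> 'a \<Rightarrow> real" and g :: "'j \<Rightarrow> 'a \<Rightarrow> real"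
  assumes f: "\<And>a. a \<in> A \<Longrightarrow> integrable M (f a)" and g: "\<And>b. b \<in> B \<Longrightarrow> integrable M (g b)"
    and eq: "\<And>x y. (\<Sum>a\<in>A. c a * (f a x * f a y)) = (\<Sum>b\<in>B. d b * (g b x * g b y))"
  shows "(\<Sum>a\<in>A. c a * (\<integral>x. f a x \<partial>M)\<^sup>2) = (\<Sum>b\<in>B. d b * (\<integral>x. g b x \<partial>M)\<^sup>2)"
proof -
  have *: "(\<integral>x. (\<integral>y. (\<Sum>a\<in>A. c a * (f a x * f a y)) \<partial>M) \<partial>M) = (\<Sum>a\<in>A. c a * (\<integral>x. f a x \<partial>M)\<^sup>2)"
    if "\<And>a. a \<in> A \<Longrightarrow> integrable M (f a)" for A :: "'i2 set" and f :: "'i2 \<Rightarrow> 'a \<Rightarrow> real" and c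
    using that by (simp add: Bochner_Integration.integral_sum power2_eq_square)
  show ?thesis
    using *[of A f c] *[of B g d] f g eq by simp
qed

text \<open>
  The expansion of the likelihood ratio in the orthogonal basis of centred edge products, by
  Parseval's identity: each edge set contributes the square of the mean of its centred product under
  the alternative, divided by its variance under the null.
\<close>
lemma chi2_mixture:
  assumes M: "prob_space M"
    and meas [measurable]: "\<And>i j. i < j \<Longrightarrow> j < n \<Longrightarrow> (\<lambda>\<pi>. \<Omega> \<pi> i j) \<in> borel_measurable M"
    and ae: "AE \<pi> in M. edge_probs n (\<Omega> \<pi>)"
    and p: "\<And>i j. i < j \<Longrightarrow> j < n \<Longrightarrow> 0 < p i j \<and> p i j < 1"
  shows "chi2_dist (measure_pmf (adj_pmf n p)) (M \<bind> (\<lambda>\<pi>. measure_pmf (adj_pmf n (\<Omega> \<pi>))))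
    = (\<Sum>J\<in>Pow (pairs n). (\<integral>\<pi>. (\<Prod>(i, j)\<in>J. \<Omega> \<pi> i j - p i j) \<partial>M)\<^sup>2 / (\<Prod>(i, j)\<in>J. p i j * (1 - p i j))) - 1"
proof -
  interpret M: prob_space M by fact
  define N where "N = M \<bind> (\<lambda>\<pi>. measure_pmf (adj_pmf n (\<Omega> \<pi>)))"
  have kernel: "(\<lambda>\<pi>. measure_pmf (adj_pmf n (\<Omega> \<pi>))) \<in> measurable M (subprob_algebra (count_space UNIV))"
    by (rule adj_pmf_kernel_measurable) (rule meas)
  have N: "sets N = UNIV" using sets_bind[of M "\<lambda>\<pi>. measure_pmf (adj_pmf n (\<Omega> \<pi>))" "count_space UNIV"] M.not_empty
    by (simp add: N_def)
  have em: "emeasure N X = (\<integral>\<^sup>+\<pi>. emeasure (adj_pmf n (\<Omega> \<pi>)) X \<partial>M)" for X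
    unfolding N_def by (rule emeasure_bind[OF M.not_empty kernel]) simp
  have measM: "(\<lambda>\<pi>. (case e of (i, j) \<Rightarrow> \<Omega> \<pi> i j)) \<in> borel_measurable M" if "e \<in> pairs n" for e
    using that meas by (auto simp: pairs_def)
  have weight_int: "integrable M (\<lambda>\<pi>. graph_weight n (\<Omega> \<pi>) A)" if A: "A \<in> Pow (pairs n)" for A
  proof (rule M.integrable_const_bound[of _ 1])
    show "AE \<pi> in M. norm (graph_weight n (\<Omega> \<pi>) A) \<le> 1"
      using ae
    proof eventually_elim
      case (elim \<pi>)
      then show ?case using pmf_adj_of_eq_weight[of A n "\<Omega> \<pi>"] A pmf_le_1[of "adj_pmf n (\<Omega> \<pi>)" "adj_of A"] by (simp flip: pmf_adj_of_eq_weight)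
    qed
    show "(\<lambda>\<pi>. graph_weight n (\<Omega> \<pi>) A) \<in> borel_measurable M"
      using measM A by (auto simp: graph_weight_def case_prod_unfold subset_iff intro!: borel_measurable_times borel_measurable_prod borel_measurable_diff)
  qed
  have prod_int: "integrable M (\<lambda>\<pi>. \<Prod>(i, j)\<in>J. \<Omega> \<pi> i j - p i j)" if J: "J \<in> Pow (pairs n)" for J
  proof (rule M.integrable_const_bound[of _ 1])
    show "AE \<pi> in M. norm (\<Prod>(i, j)\<in>J. \<Omega> \<pi> i j - p i j) \<le> 1"
      using ae
    proof eventually_elim
      case (elim \<pi>)
      have "\<bar>\<Omega> \<pi> i j - p i j\<bar> \<le> 1" if "(i, j) \<in> J" for i j
        using that J elim p[of i j] by (auto simp: edge_probs_def pairs_def abs_le_iff subset_iff) (smt (verit))+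
      then show ?case by (auto simp: case_prod_unfold abs_prod intro!: prod_le_1)
    qed
    show "(\<lambda>\<pi>. \<Prod>(i, j)\<in>J. \<Omega> \<pi> i j - p i j) \<in> borel_measurable M"
      using measM J by (auto simp: case_prod_unfold subset_iff intro!: borel_measurable_prod borel_measurable_diff)
  qed
  have mN: "measure N {adj_of A} = (\<integral>\<pi>. graph_weight n (\<Omega> \<pi>) A \<partial>M)" if A: "A \<in> Pow (pairs n)" for A
  proof -
    have w: "AE \<pi> in M. pmf (adj_pmf n (\<Omega> \<pi>)) (adj_of A) = graph_weight n (\<Omega> \<pi>) A"
      using ae by eventually_elim (use A pmf_adj_of_eq_weight in auto)
    have nonneg: "AE \<pi> in M. 0 \<le> graph_weight n (\<Omega> \<pi>) A"
      using w by eventually_elim (metis pmf_nonneg)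
    from w have "emeasure N {adj_of A} = (\<integral>\<^sup>+\<pi>. ennreal (graph_weight n (\<Omega> \<pi>) A) \<partial>M)"
      unfolding em by (intro nn_integral_cong_AE) (auto simp: emeasure_pmf_single)
    also have "\<dots> = ennreal (\<integral>\<pi>. graph_weight n (\<Omega> \<pi>) A \<partial>M)"
      by (intro nn_integral_eq_integral weight_int A nonneg)
    moreover have "0 \<le> (\<integral>\<pi>. graph_weight n (\<Omega> \<pi>) A \<partial>M)"
      by (intro integral_nonneg_AE nonneg)
    ultimately show ?thesis by (simp add: measure_def)
  qed
  have p': "edge_probs n p" using p by (auto simp: edge_probs_def less_imp_le)
  have wp: "graph_weight n p A > 0" if "A \<in> Pow (pairs n)" for A
    using that p unfolding graph_weight_def by (intro mult_pos_pos prod_pos) (auto simp: pairs_def)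
  have set_p: "set_pmf (adj_pmf n p) = adj_of ` Pow (pairs n)"
  proof
    show "adj_of ` Pow (pairs n) \<subseteq> set_pmf (adj_pmf n p)"
    proof
      fix x assume "x \<in> adj_of ` Pow (pairs n)"
      then obtain A where "A \<in> Pow (pairs n)" "x = adj_of A" by blast
      then show "x \<in> set_pmf (adj_pmf n p)"
        using wp[of A] pmf_adj_of_eq_weight[of A n p] p' by (simp add: set_pmf_iff)
    qed
  qed (rule set_adj_pmf)
  have "chi2_dist (measure_pmf (adj_pmf n p)) N
      = (\<Sum>x\<in>set_pmf (adj_pmf n p). (measure N {x})\<^sup>2 / pmf (adj_pmf n p) x) - 1"
  proof (rule chi2_dist_pmf)
    have "emeasure N UNIV = (\<integral>\<^sup>+\<pi>. 1 \<partial>M)" unfolding em using measure_pmf.emeasure_space_1 by (intro nn_integral_cong) simp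
    then have "emeasure N UNIV = 1" by (simp add: M.emeasure_space_1)
    moreover have "space N = UNIV" using N sets_eq_imp_space_eq[of N "count_space UNIV"] by simp
    ultimately show "finite_measure N" by (intro finite_measureI) auto
    have "emeasure (adj_pmf n (\<Omega> \<pi>)) (- set_pmf (adj_pmf n p)) = 0" for \<pi>
    proof -
      have "- set_pmf (adj_pmf n p) \<inter> set_pmf (adj_pmf n (\<Omega> \<pi>)) = {}"
        unfolding set_p using set_adj_pmf[of n "\<Omega> \<pi>"] by blast
      then show ?thesis by (metis emeasure_Int_set_pmf emeasure_empty)
    qed
    then show "emeasure N (- set_pmf (adj_pmf n p)) = 0" unfolding em by simp
  qed (use N set_p in auto)
  also have "(\<Sum>x\<in>set_pmf (adj_pmf n p). (measure N {x})\<^sup>2 / pmf (adj_pmf n p) x)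
      = (\<Sum>A\<in>Pow (pairs n). 1 / graph_weight n p A * (\<integral>\<pi>. graph_weight n (\<Omega> \<pi>) A \<partial>M)\<^sup>2)"
    unfolding set_p by (subst sum.reindex[OF inj_adj_of]) (simp add: mN pmf_adj_of_eq_weight p')
  also have "\<dots> = (\<Sum>J\<in>Pow (pairs n). 1 / (\<Prod>(i, j)\<in>J. p i j * (1 - p i j)) * (\<integral>\<pi>. (\<Prod>(i, j)\<in>J. \<Omega> \<pi> i j - p i j) \<partial>M)\<^sup>2)"
    by (intro sum_square_integrals weight_int prod_int graph_weight_identity p)
  finally show ?thesis by (simp add: N_def)
qed

text \<open>
  The vertex \<open>v\<close> occurs in a single factor, so integrating over its variable first gives \<open>0\<close>.
\<close>
lemma degenerate_leaf_integral:
  fixes g :: "'a \<Rightarrow> 'a \<Rightarrow> real"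
  assumes F: "prob_space F" and J: "J \<subseteq> pairs n" and v: "v < n" "deg J v = 1"
    and int: "integrable (iid n F) (\<lambda>\<pi>. \<Prod>(i, j)\<in>J. g (\<pi> i) (\<pi> j))"
    and deg: "\<And>z. (\<integral>y. g y z \<partial>F) = 0" "\<And>z. (\<integral>y. g z y \<partial>F) = 0"
  shows "(\<integral>\<pi>. (\<Prod>(i, j)\<in>J. g (\<pi> i) (\<pi> j)) \<partial>iid n F) = 0"
proof -
  interpret F: prob_space F by fact
  interpret product_sigma_finite "\<lambda>_. F" by unfold_locales
  obtain e where e: "{e \<in> J. fst e = v \<or> snd e = v} = {e}"
    using v(2) by (auto simp: deg_def card_1_singleton_iff)
  define J' where "J' = J - {e}"
  have J': "J = insert e J'" "e \<notin> J'" using e by (auto simp: J'_def)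
  have fin: "finite J'" using J finite_subset[OF _ finite_pairs] by (auto simp: J'_def)
  have away: "i \<noteq> v \<and> j \<noteq> v" if ij: "(i, j) \<in> J'" for i j
  proof (rule ccontr)
    assume "\<not> (i \<noteq> v \<and> j \<noteq> v)"
    then have "(i, j) \<in> {e \<in> J. fst e = v \<or> snd e = v}" using ij by (auto simp: J'_def)
    then show False using ij unfolding e by (simp add: J'_def)
  qed
  have ev: "fst e = v \<and> snd e \<noteq> v \<or> snd e = v \<and> fst e \<noteq> v"
  proof -
    have "e \<in> {e \<in> J. fst e = v \<or> snd e = v}" unfolding e by simp
    moreover from this have "e \<in> pairs n" using J by blast
    then have "fst e < snd e" by (auto simp: pairs_def)
    ultimately show ?thesis by auto
  qed
  have ins: "{..<n} = insert v ({..<n} - {v})" using v by auto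
  have inner: "(\<integral>y. (\<Prod>(i, j)\<in>J. g ((x(v := y)) i) ((x(v := y)) j)) \<partial>F) = 0" for x
  proof -
    have "(\<Prod>(i, j)\<in>J'. g ((x(v := y)) i) ((x(v := y)) j)) = (\<Prod>(i, j)\<in>J'. g (x i) (x j))" for y
      using away by (intro prod.cong) auto
    then have "(\<integral>y. (\<Prod>(i, j)\<in>J. g ((x(v := y)) i) ((x(v := y)) j)) \<partial>F)
      = (\<integral>y. g ((x(v := y)) (fst e)) ((x(v := y)) (snd e)) \<partial>F) * (\<Prod>(i, j)\<in>J'. g (x i) (x j))"
      unfolding J'(1) using J'(2) fin by (simp add: case_prod_unfold)
    moreover have "(\<integral>y. g ((x(v := y)) (fst e)) ((x(v := y)) (snd e)) \<partial>F) = 0"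
      using ev deg by auto
    ultimately show ?thesis by simp
  qed
  have "(\<integral>\<pi>. (\<Prod>(i, j)\<in>J. g (\<pi> i) (\<pi> j)) \<partial>iid n F)
    = (\<integral>x. (\<integral>y. (\<Prod>(i, j)\<in>J. g ((x(v := y)) i) ((x(v := y)) j)) \<partial>F) \<partial>PiM ({..<n} - {v}) (\<lambda>_. F))"
    by (subst ins, rule product_integral_insert) (use int ins in auto)
  also have "\<dots> = 0" unfolding inner by simp
  finally show ?thesis .
qed

section \<open>Mixed-membership alternatives\<close>

lemma simplex_mean:
  fixes F :: "(real ^ 'k) measure"
  assumes F: "prob_space F" "sets F = sets borel" "AE x in F. x \<in> std_simplex"
  shows "integrable F (\<lambda>x. x)" "(\<Sum>k\<in>UNIV. (\<integral>x. x \<partial>F) $ k) = 1"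
proof -
  interpret prob_space F by fact
  show int: "integrable F (\<lambda>x. x)"
  proof (rule integrable_const_bound[of _ 1])
    show "AE x in F. norm x \<le> 1" using F(3) by eventually_elim (rule norm_le_1_simplex)
    show "(\<lambda>x. x) \<in> borel_measurable F" using F(2) by simp
  qed
  have "bounded_linear (\<lambda>x :: real ^ 'k. \<Sum>k\<in>UNIV. x $ k)"
    by (intro bounded_linear_sum bounded_linear_vec_nth)
  then have "(\<Sum>k\<in>UNIV. (\<integral>x. x \<partial>F) $ k) = (\<integral>x. (\<Sum>k\<in>UNIV. x $ k) \<partial>F)"
    using integral_bounded_linear[OF _ int] by fastforce
  also have "\<dots> = (\<integral>x. 1 \<partial>F)"
  proof (rule integral_cong_AE)
    have "(\<lambda>x :: real ^ 'k. \<Sum>k\<in>UNIV. x $ k) \<in> borel_measurable borel"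
      by (intro borel_measurable_continuous_onI continuous_intros)
    then show "(\<lambda>x. \<Sum>k\<in>UNIV. x $ k) \<in> borel_measurable F"
      by (simp add: measurable_cong_sets[OF F(2) refl])
  qed (use F(3) in \<open>auto simp: std_simplex_def elim!: eventually_mono\<close>)
  finally show "(\<Sum>k\<in>UNIV. (\<integral>x. x \<partial>F) $ k) = 1" by (simp add: prob_space)
qed

lemma centred_form_mean_zero:
  fixes F :: "(real ^ 'k) measure"
  assumes F: "prob_space F" "integrable F (\<lambda>x. x)" and h: "h = (\<integral>x. x \<partial>F)"
  shows "(\<integral>y. centred_form P D h y z \<partial>F) = 0" "(\<integral>y. centred_form P D h z y \<partial>F) = 0"
proof -
  interpret prob_space F by fact
  have *: "(\<integral>y. T (y - h) \<partial>F) = 0" if "bounded_linear T" for T :: "real ^ 'k \<Rightarrow> real"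
  proof -
    have "(\<integral>y. T (y - h) \<partial>F) = T (\<integral>y. y - h \<partial>F)"
      using F(2) by (intro integral_bounded_linear that) auto
    also have "(\<integral>y. y - h \<partial>F) = 0" using F(2) by (simp add: h prob_space)
    finally show ?thesis using linear_0 bounded_linear.linear[OF that] by simp
  qed
  have D: "bounded_linear ((*v) A)" for A :: "real ^ 'k ^ 'k" by (rule matrix_vector_mul_bounded_linear)
  show "(\<integral>y. centred_form P D h y z \<partial>F) = 0"
    unfolding centred_form_def
    by (rule *) (rule bounded_linear_compose[OF bounded_linear_inner_left D])
  show "(\<integral>y. centred_form P D h z y \<partial>F) = 0"
    unfolding centred_form_def
    by (rule *) (rule bounded_linear_compose[OF bounded_linear_inner_right bounded_linear_compose[OF D D]])
qed

lemma alt_Omega_eq: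
  fixes P D :: "real ^ 'k ^ 'k"
  assumes D: "diag_scaling P h D" and sym: "transpose P = P" and h: "(\<Sum>k\<in>UNIV. h $ k) = 1"
    and simplex: "\<pi> i \<in> std_simplex" "\<pi> j \<in> std_simplex"
  shows "alt_Omega D P \<theta> \<pi> i j = \<theta> i * \<theta> j * (1 + centred_form P D h (\<pi> i) (\<pi> j))"
proof -
  have diag: "\<forall>k l. k \<noteq> l \<longrightarrow> D $ k $ l = 0" and pos: "D $ k $ k > 0" for k
    using D by (auto simp: diag_scaling_def)
  have sum1: "(\<Sum>k\<in>UNIV. x $ k) = 1" if "x \<in> std_simplex" for x :: "real ^ 'k"
    using that by (simp add: std_simplex_def)
  have l1: "l1_norm (D *v x) > 0" if x: "x \<in> std_simplex" for x
  proof -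
    obtain k where k: "x $ k \<noteq> 0" using sum1[OF x] by (metis (no_types, lifting) sum.neutral zero_neq_one)
    then have "0 < \<bar>(D *v x) $ k\<bar>" using pos[of k] by (simp add: diag_mult_nth[OF diag])
    also have "\<dots> \<le> l1_norm (D *v x)" unfolding l1_norm_def by (intro member_le_sum) auto
    finally show ?thesis .
  qed
  have "alt_Omega D P \<theta> \<pi> i j = \<theta> i * \<theta> j * ((D *v \<pi> i) \<bullet> (P *v (D *v \<pi> j)))"
    using l1[OF simplex(1)] l1[OF simplex(2)]
    by (simp add: alt_Omega_def dcmm_Omega_def tilde_theta_def tilde_pi_def matrix_vector_mult_scaleR)
  also have "(D *v \<pi> i) \<bullet> (P *v (D *v \<pi> j)) = 1 + centred_form P D h (\<pi> i) (\<pi> j)"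
    by (rule scaled_form_eq(1)[OF D]) (use simplex sum1 h sym in auto)
  finally show ?thesis .
qed

lemma borel_measurable_matrix_vector_mult [measurable]:
  "(\<lambda>x. A *v x) \<in> borel_measurable borel" for A :: "real ^ 'k ^ 'k"
  by (intro borel_measurable_continuous_onI linear_continuous_on) simp

lemma borel_measurable_l1_norm [measurable]: "l1_norm \<in> borel_measurable borel"
  unfolding l1_norm_def by (intro borel_measurable_continuous_onI continuous_intros)

lemma alt_Omega_measurable:
  fixes F :: "(real ^ 'k) measure"
  assumes F: "sets F = sets borel" and "i < n" "j < n"
  shows "(\<lambda>\<pi>. alt_Omega D P \<theta> \<pi> i j) \<in> borel_measurable (iid n F)"
proof -
  have [measurable]: "(\<lambda>\<pi>. \<pi> k) \<in> borel_measurable (iid n F)" if "k < n" for k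
    using measurable_component_singleton[of k "{..<n}" "\<lambda>_. F"] that
    by (simp add: measurable_cong_sets[OF refl F])
  note [measurable] = this[OF \<open>i < n\<close>] this[OF \<open>j < n\<close>]
  show ?thesis
    unfolding alt_Omega_def dcmm_Omega_def tilde_theta_def tilde_pi_def by measurable
qed

text \<open>
  The coefficient of the edge set \<open>J\<close> is the mean of a product of the centred form over the edges,
  which vanishes if \<open>J\<close> has a leaf and is at most \<open>\<eta> ^ card J\<close> otherwise. Its weight
  \<open>\<Prod>(i, j)\<in>J. \<theta> i * \<theta> j / (1 - \<theta> i * \<theta> j)\<close> is at most the same product with \<open>1 - c\<^sup>2\<close> in the
  denominators, which puts the sum into the form treated by \<open>leafless_sum_le\<close>.
\<close>
lemma chi2_dcmm_bounds:
  fixes F :: "(real ^ 'k) measure" and P D :: "real ^ 'k ^ 'k"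
  assumes n: "0 < n"
    and F: "prob_space F" "sets F = sets borel" "AE x in F. x \<in> std_simplex"
    and h: "h = (\<integral>x. x \<partial>F)"
    and sym: "transpose P = P" and D: "diag_scaling P h D"
    and model: "AE \<pi> in iid n F. edge_probs n (alt_Omega D P \<theta> \<pi>)"
    and \<theta>: "\<And>i. i < n \<Longrightarrow> 0 < \<theta> i" "\<And>i. i < n \<Longrightarrow> \<theta> i \<le> c" and c: "c < 1"
    and \<eta>: "0 \<le> \<eta>" "\<And>y z. y \<in> std_simplex \<Longrightarrow> z \<in> std_simplex \<Longrightarrow> \<bar>centred_form P D h y z\<bar> \<le> \<eta>"
    and small: "10 * (\<eta>\<^sup>2 / (1 - c\<^sup>2) * (\<Sum>i<n. (\<theta> i)\<^sup>2)) \<le> 1"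
  shows "chi2_dist (null_law n \<theta>) (alt_law n F D P \<theta>) \<in>
    {0 .. exp (4 * (\<eta>\<^sup>2 / (1 - c\<^sup>2) * (\<Sum>i<n. (\<theta> i)\<^sup>2))) - 1}"
proof -
  interpret F: prob_space F by fact
  interpret iid: prob_space "iid n F" by (intro prob_space_PiM F)
  define b where "b = \<eta>\<^sup>2 / (1 - c\<^sup>2)"
  define \<kappa> where "\<kappa> = centred_form P D h"
  define I where "I = (\<lambda>J. \<integral>\<pi>. (\<Prod>(i, j)\<in>J. \<kappa> (\<pi> i) (\<pi> j)) \<partial>iid n F)"
  define t where "t = (\<lambda>J. (\<integral>\<pi>. (\<Prod>(i, j)\<in>J. alt_Omega D P \<theta> \<pi> i j - \<theta> i * \<theta> j) \<partial>iid n F)\<^sup>2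
      / (\<Prod>(i, j)\<in>J. \<theta> i * \<theta> j * (1 - \<theta> i * \<theta> j)))"
  have p: "0 < \<theta> i * \<theta> j \<and> \<theta> i * \<theta> j \<le> c\<^sup>2 \<and> c\<^sup>2 < 1" if "i < n" "j < n" for i j
  proof -
    have "0 < c" using \<theta>(1)[OF that(1)] \<theta>(2)[OF that(1)] by linarith
    then have "c * c < 1 * 1" using c by (intro mult_strict_mono) auto
    moreover have "\<theta> i * \<theta> j \<le> c * c"
      using \<theta>[OF that(1)] \<theta>[OF that(2)] \<open>0 < c\<close> by (intro mult_mono) auto
    ultimately show ?thesis using \<theta>(1)[OF that(1)] \<theta>(1)[OF that(2)] by (simp add: power2_eq_square)
  qed
  have null_p: "0 < null_Omega \<theta> i j \<and> null_Omega \<theta> i j < 1" if "i < j" "j < n" for i j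
    using p[of i j] that by (auto simp: null_Omega_def)
  have chi2: "chi2_dist (null_law n \<theta>) (alt_law n F D P \<theta>) = (\<Sum>J\<in>Pow (pairs n). t J) - 1"
    unfolding null_law_def alt_law_def t_def
    by (subst chi2_mixture[OF iid.prob_space_axioms _ model null_p])
      (auto simp: null_Omega_def intro!: alt_Omega_measurable F)
  have fst_pairs: "i < n" "j < n" if "(i, j) \<in> pairs n" for i j using that by (auto simp: pairs_def)
  have simplex: "AE \<pi> in iid n F. \<forall>i\<in>{..<n}. \<pi> i \<in> std_simplex"
    using F by (intro AE_finite_allI AE_PiM_component) auto
  have [measurable]: "(\<lambda>\<pi>. \<pi> k) \<in> borel_measurable (iid n F)" if "k < n" for k
    using measurable_component_singleton[of k "{..<n}" "\<lambda>_. F"] that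
    by (simp add: measurable_cong_sets[OF refl F(2)])
  have \<kappa>_meas: "(\<lambda>\<pi>. \<kappa> (\<pi> i) (\<pi> j)) \<in> borel_measurable (iid n F)" if [measurable]: "i < n" "j < n" for i j
    unfolding \<kappa>_def centred_form_def by measurable
  have \<kappa>_bound: "AE \<pi> in iid n F. \<bar>\<Prod>(i, j)\<in>J. \<kappa> (\<pi> i) (\<pi> j)\<bar> \<le> \<eta> ^ card J" if J: "J \<subseteq> pairs n" for J
    using simplex
  proof eventually_elim
    case (elim \<pi>)
    have "\<bar>\<Prod>(i, j)\<in>J. \<kappa> (\<pi> i) (\<pi> j)\<bar> \<le> (\<Prod>e\<in>J. \<eta>)"
      unfolding abs_prod using J elim \<eta>(2) fst_pairs by (intro prod_mono) (auto simp: \<kappa>_def)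
    then show ?case by simp
  qed
  have \<kappa>_int: "integrable (iid n F) (\<lambda>\<pi>. \<Prod>(i, j)\<in>J. \<kappa> (\<pi> i) (\<pi> j))" if J: "J \<subseteq> pairs n" for J
    using \<kappa>_bound[OF J] J fst_pairs
    by (intro iid.integrable_const_bound) (auto simp: case_prod_unfold intro!: borel_measurable_prod \<kappa>_meas)
  have I_leaf: "I J = 0" if J: "J \<subseteq> pairs n" "\<not> leafless n J" for J
  proof -
    obtain v where v: "v < n" "deg J v = 1" using J(2) by (auto simp: leafless_def)
    show ?thesis unfolding I_def
      by (rule degenerate_leaf_integral[OF F(1) J(1) v \<kappa>_int[OF J(1)]])
        (simp_all only: \<kappa>_def centred_form_mean_zero[OF F(1) simplex_mean(1)[OF F] h])
  qed
  have I_bound: "\<bar>I J\<bar> \<le> \<eta> ^ card J" if J: "J \<subseteq> pairs n" for J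
  proof -
    have "\<bar>I J\<bar> \<le> (\<integral>\<pi>. \<bar>\<Prod>(i, j)\<in>J. \<kappa> (\<pi> i) (\<pi> j)\<bar> \<partial>iid n F)"
      unfolding I_def by (rule integral_abs_bound)
    also have "\<dots> \<le> (\<integral>\<pi>. \<eta> ^ card J \<partial>iid n F)"
      using \<kappa>_int[OF J] \<kappa>_bound[OF J] by (intro integral_mono_AE) auto
    finally show ?thesis by (simp add: iid.prob_space)
  qed
  have t: "t J = (\<Prod>(i, j)\<in>J. \<theta> i * \<theta> j / (1 - \<theta> i * \<theta> j)) * (I J)\<^sup>2" if J: "J \<subseteq> pairs n" for J
  proof -
    have "(\<integral>\<pi>. (\<Prod>(i, j)\<in>J. alt_Omega D P \<theta> \<pi> i j - \<theta> i * \<theta> j) \<partial>iid n F)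
      = (\<integral>\<pi>. (\<Prod>(i, j)\<in>J. \<theta> i * \<theta> j) * (\<Prod>(i, j)\<in>J. \<kappa> (\<pi> i) (\<pi> j)) \<partial>iid n F)"
    proof (rule integral_cong_AE)
      show "AE \<pi> in iid n F. (\<Prod>(i, j)\<in>J. alt_Omega D P \<theta> \<pi> i j - \<theta> i * \<theta> j)
          = (\<Prod>(i, j)\<in>J. \<theta> i * \<theta> j) * (\<Prod>(i, j)\<in>J. \<kappa> (\<pi> i) (\<pi> j))"
        using simplex
      proof eventually_elim
        case (elim \<pi>)
        have "alt_Omega D P \<theta> \<pi> i j - \<theta> i * \<theta> j = \<theta> i * \<theta> j * \<kappa> (\<pi> i) (\<pi> j)" if "(i, j) \<in> J" for i j
          using alt_Omega_eq[OF D sym, of \<pi> i j \<theta>] simplex_mean(2)[OF F] elim that J fst_pairs[of i j]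
          by (auto simp: \<kappa>_def algebra_simps simp flip: h)
        then show ?case unfolding prod.distrib[symmetric] by (intro prod.cong) auto
      qed
    qed (use J fst_pairs in \<open>auto simp: case_prod_unfold intro!: borel_measurable_prod borel_measurable_diff borel_measurable_times \<kappa>_meas alt_Omega_measurable F\<close>)
    also have "\<dots> = (\<Prod>(i, j)\<in>J. \<theta> i * \<theta> j) * I J" by (simp add: I_def)
    finally have "t J = (\<Prod>(i, j)\<in>J. \<theta> i * \<theta> j)\<^sup>2 / (\<Prod>(i, j)\<in>J. \<theta> i * \<theta> j * (1 - \<theta> i * \<theta> j)) * (I J)\<^sup>2"
      by (simp add: t_def power_mult_distrib)
    also have "(\<Prod>(i, j)\<in>J. \<theta> i * \<theta> j)\<^sup>2 / (\<Prod>(i, j)\<in>J. \<theta> i * \<theta> j * (1 - \<theta> i * \<theta> j))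
      = (\<Prod>(i, j)\<in>J. \<theta> i * \<theta> j / (1 - \<theta> i * \<theta> j))"
    proof -
      have cancel: "x\<^sup>2 / (x * (1 - x)) = x / (1 - x)" if "x \<noteq> 0" for x :: real
        using that by (simp add: power2_eq_square)
      have "\<theta> (fst e) * \<theta> (snd e) \<noteq> 0" if "e \<in> J" for e
        using p[of "fst e" "snd e"] fst_pairs[of "fst e" "snd e"] that J by auto
      then show ?thesis
        unfolding prod_power_distrib case_prod_unfold prod_dividef[symmetric]
        by (intro prod.cong refl cancel)
    qed
    finally show ?thesis .
  qed
  have factor: "0 \<le> \<theta> i * \<theta> j / (1 - \<theta> i * \<theta> j)" "\<theta> i * \<theta> j / (1 - \<theta> i * \<theta> j) \<le> \<theta> i * \<theta> j / (1 - c\<^sup>2)"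
    if "(i, j) \<in> pairs n" for i j
    using p[OF fst_pairs[OF that]] by (auto intro!: divide_nonneg_nonneg divide_left_mono mult_pos_pos)
  have t_nonneg: "0 \<le> t J" if "J \<subseteq> pairs n" for J
    unfolding t[OF that] using that factor by (intro mult_nonneg_nonneg prod_nonneg) auto
  have b: "b \<ge> 0" using p[OF n n] by (simp add: b_def)
  \<comment> \<open>The factor \<open>\<eta>\<^sup>2 / (1 - c\<^sup>2)\<close> of each edge is shared equally by its two endpoints.\<close>
  define a where "a = (\<lambda>i. sqrt b * \<bar>\<theta> i\<bar>)"
  have t_le: "t J \<le> of_bool (leafless n J) * (\<Prod>(i, j)\<in>J. a i * a j)" if J: "J \<subseteq> pairs n" for J
  proof (cases "leafless n J")
    case True
    have "t J \<le> (\<Prod>(i, j)\<in>J. \<theta> i * \<theta> j / (1 - c\<^sup>2)) * (\<eta> ^ card J)\<^sup>2"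
      unfolding t[OF J]
    proof (rule mult_mono)
      show "(\<Prod>(i, j)\<in>J. \<theta> i * \<theta> j / (1 - \<theta> i * \<theta> j)) \<le> (\<Prod>(i, j)\<in>J. \<theta> i * \<theta> j / (1 - c\<^sup>2))"
        using J factor by (intro prod_mono) auto
      show "(I J)\<^sup>2 \<le> (\<eta> ^ card J)\<^sup>2"
        using I_bound[OF J] by (metis abs_ge_zero power2_abs power_mono)
      show "0 \<le> (\<Prod>(i, j)\<in>J. \<theta> i * \<theta> j / (1 - c\<^sup>2))"
        using J order_trans[OF factor(1) factor(2)] by (intro prod_nonneg) auto
    qed simp
    also have "(\<eta> ^ card J)\<^sup>2 = (\<Prod>(i, j)\<in>J. \<eta>\<^sup>2)"
      by (simp add: power_even_eq[symmetric] power_mult)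
    also have "(\<Prod>(i, j)\<in>J. \<theta> i * \<theta> j / (1 - c\<^sup>2)) * (\<Prod>(i, j)\<in>J. \<eta>\<^sup>2) = (\<Prod>(i, j)\<in>J. a i * a j)"
      unfolding prod.distrib[symmetric]
    proof (intro prod.cong refl, clarsimp)
      fix i j assume "(i, j) \<in> J"
      then have ij: "i < n" "j < n" using J fst_pairs by blast+
      have "a i * a j = b * (\<theta> i * \<theta> j)"
        using b \<theta>(1)[OF ij(1)] \<theta>(1)[OF ij(2)] by (simp add: a_def algebra_simps)
      then show "\<theta> i * \<theta> j * \<eta>\<^sup>2 / (1 - c\<^sup>2) = a i * a j" by (simp add: b_def)
    qed
    finally show ?thesis using True by simp
  next
    case False
    then show ?thesis unfolding t[OF J] by (simp add: I_leaf[OF J])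
  qed
  have a2: "(\<Sum>i<n. (a i)\<^sup>2) = b * (\<Sum>i<n. (\<theta> i)\<^sup>2)"
    using b by (simp add: a_def power_mult_distrib sum_distrib_left)
  have "(\<Sum>J\<in>Pow (pairs n). t J) \<le> (\<Sum>J\<in>Pow (pairs n). of_bool (leafless n J) * (\<Prod>(i, j)\<in>J. a i * a j))"
    using t_le by (intro sum_mono) auto
  also have "\<dots> \<le> exp (4 * (\<Sum>i<n. (a i)\<^sup>2))"
  proof (rule leafless_sum_le)
    show "0 \<le> a i" for i using b by (simp add: a_def)
  qed (use small a2 b_def in simp)
  finally have upper: "(\<Sum>J\<in>Pow (pairs n). t J) \<le> exp (4 * (b * (\<Sum>i<n. (\<theta> i)\<^sup>2)))" by (simp add: a2)
  \<comment> \<open>The empty edge set contributes exactly \<open>1\<close>, and all other terms are nonnegative.\<close>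
  have "1 = t {}" by (simp add: t I_def iid.prob_space)
  also have "\<dots> = (\<Sum>J\<in>{{}}. t J)" by simp
  also have "\<dots> \<le> (\<Sum>J\<in>Pow (pairs n). t J)" using t_nonneg by (intro sum_mono2) auto
  finally show ?thesis using upper by (simp add: chi2 b_def)
qed

theorem theorem3p4:
  fixes F :: "(real ^ 'k::finite) measure"
    and h :: "real ^ 'k"
    and \<theta> :: "nat \<Rightarrow> nat \<Rightarrow> real"
    and P D :: "nat \<Rightarrow> real ^ 'k ^ 'k"
    and c\<^sub>0 C :: real
  assumes K: "CARD('k) > 1"
    and F: "prob_space F" "sets F = sets borel" "AE x in F. x \<in> std_simplex"
    and h: "h = (\<integral>x. x \<partial>F)"
    and theta_pos: "\<And>n i. n \<ge> 1 \<Longrightarrow> i < n \<Longrightarrow> \<theta> n i > 0"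
    and P_sym: "\<And>n. n \<ge> 1 \<Longrightarrow> transpose (P n) = P n"
    and P_nonneg: "\<And>n k l. n \<ge> 1 \<Longrightarrow> P n $ k $ l \<ge> 0"
    and P_diag: "\<And>n k. n \<ge> 1 \<Longrightarrow> P n $ k $ k = 1"
    and D: "\<And>n. n \<ge> 1 \<Longrightarrow> diag_scaling (P n) h (D n)"
    and alt_model:
      "\<And>n. n \<ge> 1 \<Longrightarrow> AE \<pi> in iid n F. edge_probs n (alt_Omega (D n) (P n) (\<theta> n) \<pi>)"
    and c\<^sub>0: "c\<^sub>0 < 1"
    and theta_max: "\<And>n. n \<ge> 1 \<Longrightarrow> Max (\<theta> n ` {..<n}) \<le> c\<^sub>0"
    and C: "C > 0"
    and h_min: "Min (range (\<lambda>k. h $ k)) \<ge> C"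
    and signal: "(\<lambda>n. L2_set (\<theta> n) {..<n} * \<bar>eigval_mag 2 (P n)\<bar>) \<longlonglongrightarrow> 0"
  shows "(\<lambda>n. chi2_dist (null_law n (\<theta> n)) (alt_law n F (D n) (P n) (\<theta> n))) \<longlonglongrightarrow> 0"
proof -
  have hC: "h $ k \<ge> C" for k
  proof -
    have "Min (range (\<lambda>k. h $ k)) \<le> h $ k" by (intro Min_le) auto
    then show ?thesis using h_min by linarith
  qed
  have h_simplex: "h \<in> std_simplex"
    using simplex_mean(2)[OF F] hC C by (auto simp: std_simplex_def h[symmetric] intro: order_trans less_imp_le)
  define B where "B = 4 / C + 2 / C\<^sup>2"
  have B: "B \<ge> 0" using C by (simp add: B_def)
  define s where "s = (\<lambda>n. L2_set (\<theta> n) {..<n} * \<bar>eigval_mag 2 (P n)\<bar>)"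
  define r where "r = (\<lambda>n. B\<^sup>2 / (1 - c\<^sub>0\<^sup>2) * (s n)\<^sup>2)"
  have r: "r \<longlonglongrightarrow> B\<^sup>2 / (1 - c\<^sub>0\<^sup>2) * 0\<^sup>2"
    unfolding r_def using signal by (intro tendsto_intros) (simp add: s_def)
  have bounds: "chi2_dist (null_law n (\<theta> n)) (alt_law n F (D n) (P n) (\<theta> n)) \<in> {0 .. exp (4 * r n) - 1}"
    if n: "n \<ge> 1" and small: "10 * r n \<le> 1" for n
  proof -
    define \<eta> where "\<eta> = \<bar>eigval_mag 2 (P n)\<bar> * B"
    have r_eq: "\<eta>\<^sup>2 / (1 - c\<^sub>0\<^sup>2) * (\<Sum>i<n. (\<theta> n i)\<^sup>2) = r n"
      by (simp add: r_def s_def \<eta>_def L2_set_def power_mult_distrib sum_nonneg)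
    have "\<theta> n i \<le> c\<^sub>0" if "i < n" for i
      using theta_max[OF n] that by (meson Max_ge finite_imageI finite_lessThan imageI lessThan_iff order_trans)
    moreover have "\<bar>centred_form (P n) (D n) h y z\<bar> \<le> \<eta>" if "y \<in> std_simplex" "z \<in> std_simplex" for y z
      unfolding \<eta>_def B_def using K P_sym P_nonneg P_diag D C hC h_simplex that n
      by (intro centred_form_le) auto
    ultimately have "chi2_dist (null_law n (\<theta> n)) (alt_law n F (D n) (P n) (\<theta> n)) \<in>
        {0 .. exp (4 * (\<eta>\<^sup>2 / (1 - c\<^sub>0\<^sup>2) * (\<Sum>i<n. (\<theta> n i)\<^sup>2))) - 1}"
      using n B small[folded r_eq]
      by (intro chi2_dcmm_bounds[OF _ F h P_sym[OF n] D[OF n] alt_model[OF n] theta_pos[OF n] _ c\<^sub>0])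
        (auto simp: \<eta>_def simp del: times_divide_eq_left times_divide_eq_right)
    then show ?thesis unfolding r_eq .
  qed
  have "eventually (\<lambda>n. r n < 1 / 10) sequentially"
    using order_tendstoD(2)[OF r, of "1 / 10"] by simp
  then have ev: "eventually (\<lambda>n. chi2_dist (null_law n (\<theta> n)) (alt_law n F (D n) (P n) (\<theta> n)) \<in> {0 .. exp (4 * r n) - 1}) sequentially"
    using eventually_ge_at_top[of 1] by eventually_elim (rule bounds, auto)
  have lim: "(\<lambda>n. exp (4 * r n) - 1) \<longlonglongrightarrow> 0"
    using tendsto_diff[OF tendsto_exp[OF tendsto_mult[OF tendsto_const[of 4] r]] tendsto_const[of 1]] by simp
  show ?thesis
    by (rule tendsto_sandwich[OF _ _ tendsto_const lim]) (use ev in \<open>auto elim: eventually_mono\<close>)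
qed

end
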